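(* Let $G$ be a transitive group of permutations of a finite set $\Omega$, fix $\omega\in\Omega$ with stabilizer $G_\omega$, and suppose some element of $G$ has at most two cycles on $\Omega$. If $A$ and $B$ are distinct maximal subgroups of $G$ for which $H:=A\cap B$ contains $G_\omega$, then (at least) one of the following holds: (1) $H$ is a maximal subgroup of both $A$ and $B$, and $G=AB$; or (2) $G/\mathrm{core}_G(H)$ is dihedral of order $2r$, with $r$ prime, and both $A$ and $B$ have images of order $2$ in $G/\mathrm{core}_G(H)$.
   Context: $\mathrm{core}_G(H)$ denotes the largest normal subgroup of $G$ contained in $H$. The cycles of an element $g\in G$ on $\Omega$ are the orbits of $\langle g\rangle$ on $\Omega$ (fixed points count as cycles of length $1$). $AB=\{ab: a\in A, b\in B\}$. The dihedral group of order $4$ is the Klein four-group. *)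

theory Defs
  imports "HOL-Algebra.Algebra"
begin

text \<open>A permutation group on \<open>\<Omega>\<close> is a subgroup of \<^const>\<open>BijGroup\<close>, with the induced structure.
  Its elements are maps that are \<^const>\<open>undefined\<close> off \<open>\<Omega>\<close>, and they act on \<open>\<Omega>\<close> by evaluation,
  so the action map of the library's group-action notions is \<open>\<lambda>g. g\<close>.\<close>

definition permutation_group :: "'a set \<Rightarrow> ('a \<Rightarrow> 'a) monoid \<Rightarrow> bool"
  where "permutation_group \<Omega> G \<longleftrightarrow>
    subgroup (carrier G) (BijGroup \<Omega>) \<and> G = (BijGroup \<Omega>)\<lparr>carrier := carrier G\<rparr>"

lemma permutation_group_action:
  assumes "permutation_group \<Omega> G"
  shows "group_action G \<Omega> (\<lambda>g. g)"
proof -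
  interpret B: group "BijGroup \<Omega>" by (rule group_BijGroup)
  have s: "subgroup (carrier G) (BijGroup \<Omega>)" and e: "G = (BijGroup \<Omega>)\<lparr>carrier := carrier G\<rparr>"
    using assms by (simp_all add: permutation_group_def)
  have "group G" using B.subgroup_imp_group[OF s] e by simp
  moreover have "x \<otimes>\<^bsub>G\<^esub> y = x \<otimes>\<^bsub>BijGroup \<Omega>\<^esub> y" for x y
    by (subst e) simp
  then have "(\<lambda>g. g) \<in> hom G (BijGroup \<Omega>)"
    using subgroup.subset[OF s] by (auto simp: hom_def)
  ultimately show ?thesis
    by (simp add: group_action_def group_hom_def group_hom_axioms_def group_BijGroup)
qed

definition maximal_subgroup :: "'a set \<Rightarrow> ('a, 'b) monoid_scheme \<Rightarrow> bool"
  where "maximal_subgroup M G \<longleftrightarrow>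
    subgroup M G \<and> M \<noteq> carrier G \<and>
    (\<forall>K. subgroup K G \<longrightarrow> M \<subseteq> K \<longrightarrow> K = M \<or> K = carrier G)"

definition normal_core :: "('a, 'b) monoid_scheme \<Rightarrow> 'a set \<Rightarrow> 'a set"
  where "normal_core G H = (GREATEST N. N \<lhd> G \<and> N \<subseteq> H)"

text \<open>The greatest such \<open>N\<close> exists: it is the subgroup generated by all of them.\<close>

lemma (in group) normal_core_greatest:
  assumes "subgroup H G"
  shows normal_core_normal: "normal_core G H \<lhd> G"
    and normal_core_subset: "normal_core G H \<subseteq> H"
    and normal_core_maximal: "\<And>N. N \<lhd> G \<Longrightarrow> N \<subseteq> H \<Longrightarrow> N \<subseteq> normal_core G H"
proof -
  let ?U = "\<Union>{N. N \<lhd> G \<and> N \<subseteq> H}"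
  have UH: "?U \<subseteq> H" by blast
  have UG: "?U \<subseteq> carrier G" using UH subgroup.subset[OF assms] by blast
  have n: "generate G ?U \<lhd> G"
  proof (rule normal_generateI[OF UG])
    fix h g assume "h \<in> ?U" "g \<in> carrier G"
    then show "g \<otimes> h \<otimes> inv g \<in> ?U"
      using normal.inv_op_closed2 by fastforce
  qed
  have h: "generate G ?U \<subseteq> H" by (rule generate_subgroup_incl[OF UH assms])
  have m: "N \<subseteq> generate G ?U" if "N \<lhd> G" "N \<subseteq> H" for N
    using that by (auto intro: generate.incl)
  have eq: "normal_core G H = generate G ?U"
    unfolding normal_core_def by (rule Greatest_equality) (use n h m in auto)
  show "normal_core G H \<lhd> G" "normal_core G H \<subseteq> H"
    "\<And>N. N \<lhd> G \<Longrightarrow> N \<subseteq> H \<Longrightarrow> N \<subseteq> normal_core G H"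
    unfolding eq using n h m by auto
qed

text \<open>The dihedral group of order \<open>2n\<close>, as the semidirect product of \<open>\<int>/n\<close> by the group of order
  two acting by inversion: \<open>(a, False)\<close> is the rotation by \<open>a\<close>, and \<open>(a, True)\<close> is that rotation
  composed with a fixed reflection.  For \<open>n = 2\<close> this is the Klein four-group.\<close>

definition dihedral_group :: "nat \<Rightarrow> (int \<times> bool) monoid"
  where "dihedral_group n =
    \<lparr>carrier = {0..<int n} \<times> UNIV,
     monoid.mult = \<lambda>(a, s) (b, t). ((if s then a - b else a + b) mod int n, s \<noteq> t),
     one = (0, False)\<rparr>"

lemma group_dihedral_group:
  assumes "n > 0"
  shows "group (dihedral_group n)"
proof (rule groupI)
  fix x assume x: "x \<in> carrier (dihedral_group n)"
  obtain a s where [simp]: "x = (a, s)" by (cases x)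
  show "\<exists>y\<in>carrier (dihedral_group n). y \<otimes>\<^bsub>dihedral_group n\<^esub> x = \<one>\<^bsub>dihedral_group n\<^esub>"
    using assms x
    by (intro bexI[of _ "(if s then a else (- a) mod int n, s)"])
       (auto simp: dihedral_group_def mod_simps)
qed (use assms in \<open>auto simp: dihedral_group_def mod_simps algebra_simps\<close>)

lemma order_dihedral_group: "order (dihedral_group n) = 2 * n"
  by (simp add: order_def dihedral_group_def card_cartesian_product)

lemma dihedral_group_2_squares:
  "x \<in> carrier (dihedral_group 2) \<Longrightarrow> x \<otimes>\<^bsub>dihedral_group 2\<^esub> x = \<one>\<^bsub>dihedral_group 2\<^esub>"
  by (auto simp: dihedral_group_def)

end

theory Submission
  imports Defs
begin

text \<open>
  Let \<open>C = \<langle>g\<rangle>\<close> for an element \<open>g\<close> with at most two cycles.  For a subgroup \<open>K\<close> containing the point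
  stabilizer, the cycles of \<open>g\<close> on the cosets of \<open>K\<close> correspond to the double cosets \<open>K x C\<close>, so there are at
  most two of them; in particular this holds for \<open>H = A \<inter> B\<close>.
  Call \<open>K \<ge> H\<close> transitive if \<open>K C = G\<close>.  Since \<open>C\<close> is abelian, \<open>K \<inter> C\<close> then lies in the core of \<open>K\<close>.

  The question is which overgroups \<open>K\<close>, \<open>L\<close> of \<open>H\<close> permute, meaning that \<open>K L\<close> is a subgroup.  If \<open>H\<close> is
  transitive, all of them do: each is \<open>H\<close> times a subgroup of \<open>C\<close> (\<open>set_mult_subgroup_of_transitive\<close>; this is
  Ritt's classical argument).  Suppose that \<open>H\<close> is not transitive.  An intransitive overgroup has the same two
  double cosets as \<open>H\<close>.  Hence two intransitive overgroups never generate \<open>G\<close> (\<open>not_both_intransitive\<close>),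
  and an intransitive overgroup permutes with each transitive one, because subgroups of \<open>C\<close> are
  determined by their order (\<open>set_mult_subgroup_of_intransitive\<close>).

  So if \<open>B\<close> is maximal and \<open>K\<close> is not contained in \<open>B\<close>, where now \<open>H = K \<inter> B\<close>, then \<open>K B = G\<close> unless
  \<open>H\<close> is intransitive and both \<open>K\<close> and \<open>B\<close> are transitive.  If \<open>K B \<noteq> G\<close>, let \<open>N\<close> be the core of \<open>B\<close>.
  Comparing indices in \<open>G\<close> with indices in \<open>C\<close> shows that \<open>N\<close> has index two in \<open>B\<close> and in \<open>K N\<close>
  (\<open>index_two_of_nonpermuting\<close>).  Thus \<open>G/N\<close> is generated by two involutions, one of which spans a maximal
  subgroup, and \<open>G/N\<close> is dihedral of order \<open>2r\<close> with \<open>r\<close> prime (\<open>dihedral_quotient\<close>).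

  If \<open>A B \<noteq> G\<close>, this applies to \<open>K = A\<close>; maximality of \<open>A\<close> gives \<open>A N = A\<close>, so \<open>N = H\<close> and the second
  alternative holds.  If \<open>A B = G\<close>, a subgroup \<open>K\<close> with \<open>H < K \<le> A\<close> either satisfies \<open>K B = G\<close>, and then has
  the order of \<open>A\<close>, or falls under the previous paragraph.  The latter is impossible because \<open>A B = G\<close> makes
  the prime index of \<open>B\<close> even (\<open>inter_maximal_of_permuting\<close>), hence equal to two, and then \<open>K B = G\<close>.
\<close>

section \<open>Products of subgroups\<close>

lemma mem_set_mult: "x \<in> A <#>\<^bsub>G\<^esub> B \<longleftrightarrow> (\<exists>a\<in>A. \<exists>b\<in>B. x = a \<otimes>\<^bsub>G\<^esub> b)"
  by (auto simp: set_mult_def)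

lemma mem_r_coset: "x \<in> A #>\<^bsub>G\<^esub> y \<longleftrightarrow> (\<exists>a\<in>A. x = a \<otimes>\<^bsub>G\<^esub> y)"
  by (auto simp: r_coset_def)

lemma mem_double_coset:
  "x \<in> (H #>\<^bsub>G\<^esub> y) <#>\<^bsub>G\<^esub> C \<longleftrightarrow> (\<exists>h\<in>H. \<exists>c\<in>C. x = h \<otimes>\<^bsub>G\<^esub> y \<otimes>\<^bsub>G\<^esub> c)"
  by (auto simp: set_mult_def r_coset_def)

context group
begin

lemma inv_mult_cancel [simp]:
  assumes "x \<in> carrier G" "y \<in> carrier G"
  shows "inv x \<otimes> (x \<otimes> y) = y" "x \<otimes> (inv x \<otimes> y) = y"
  using assms by (simp_all flip: m_assoc)

text \<open>The number of ways to write an element of \<open>H y C\<close> as \<open>h \<otimes> y \<otimes> c\<close> is constant.\<close>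

lemma card_double_coset:
  assumes "finite (carrier G)" "subgroup H G" "subgroup C G" and y: "y \<in> carrier G"
  shows "card ((H #> y) <#> C) * card {c \<in> C. y \<otimes> c \<otimes> inv y \<in> H} = card H * card C"
proof -
  let ?D = "{c \<in> C. y \<otimes> c \<otimes> inv y \<in> H}"
  let ?f = "\<lambda>(h, c). h \<otimes> y \<otimes> c"
  interpret H: subgroup H G by fact
  interpret C: subgroup C G by fact
  have fin: "finite H" "finite C"
    using assms(1) H.subset C.subset finite_subset by blast+
  have im: "?f ` (H \<times> C) = (H #> y) <#> C"
    unfolding set_eq_iff mem_set_mult image_iff by (force simp: mem_r_coset)
  \<comment> \<open>Two pairs \<open>(h, c)\<close> have the same product exactly when they differ by sliding an element
    \<open>d \<in> C\<close> across \<open>y\<close>, which turns it into \<open>y \<otimes> d \<otimes> inv y\<close>.\<close>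
  have fibre: "card {p \<in> H \<times> C. ?f p = z} = card ?D" if z: "z \<in> ?f ` (H \<times> C)" for z
  proof -
    obtain h c where hc: "h \<in> H" "c \<in> C" "z = h \<otimes> y \<otimes> c" using z by auto
    have *: "{p \<in> H \<times> C. ?f p = z} = (\<lambda>d. (h \<otimes> (y \<otimes> inv d \<otimes> inv y), d \<otimes> c)) ` ?D" (is "?L = ?R")
    proof
      show "?L \<subseteq> ?R"
      proof
        fix p assume p: "p \<in> ?L"
        obtain h1 c1 where p1: "p = (h1, c1)" "h1 \<in> H" "c1 \<in> C" "h1 \<otimes> y \<otimes> c1 = h \<otimes> y \<otimes> c"
          using p hc by auto
        have "inv h1 \<otimes> (h1 \<otimes> y \<otimes> c1) \<otimes> inv c = inv h1 \<otimes> (h \<otimes> y \<otimes> c) \<otimes> inv c"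
          using p1(4) by simp
        then have e: "y \<otimes> (c1 \<otimes> inv c) = inv h1 \<otimes> (h \<otimes> y)"
          using p1(2,3) hc y by (simp add: m_assoc)
        have "y \<otimes> (c1 \<otimes> inv c) \<otimes> inv y = inv h1 \<otimes> h"
          unfolding e using p1(2,3) hc y by (simp add: m_assoc)
        then have d: "c1 \<otimes> inv c \<in> ?D" using p1(2,3) hc by simp
        have "h \<otimes> (y \<otimes> inv (c1 \<otimes> inv c) \<otimes> inv y) = h \<otimes> inv (y \<otimes> (c1 \<otimes> inv c) \<otimes> inv y)"
          using p1(2,3) hc y by (simp add: m_assoc inv_mult_group)
        also have "\<dots> = h1"
          unfolding \<open>y \<otimes> (c1 \<otimes> inv c) \<otimes> inv y = inv h1 \<otimes> h\<close>
          using p1(2,3) hc y by (simp add: m_assoc inv_mult_group)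
        finally have "p = (h \<otimes> (y \<otimes> inv (c1 \<otimes> inv c) \<otimes> inv y), (c1 \<otimes> inv c) \<otimes> c)"
          using p1(1-3) hc by (simp add: m_assoc)
        with d show "p \<in> ?R" by blast
      qed
      show "?R \<subseteq> ?L"
      proof
        fix p assume "p \<in> ?R"
        then obtain d where d: "d \<in> C" "y \<otimes> d \<otimes> inv y \<in> H"
          and p: "p = (h \<otimes> (y \<otimes> inv d \<otimes> inv y), d \<otimes> c)" by auto
        have "y \<otimes> inv d \<otimes> inv y = inv (y \<otimes> d \<otimes> inv y)"
          using d y by (simp add: m_assoc inv_mult_group)
        then have "y \<otimes> inv d \<otimes> inv y \<in> H" using d by simp
        then show "p \<in> ?L"
          using d hc y unfolding p by (auto simp: m_assoc)
      qed
    qed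
    have "inj_on (\<lambda>d. (h \<otimes> (y \<otimes> inv d \<otimes> inv y), d \<otimes> c)) ?D"
      using hc by (intro inj_onI) auto
    then show ?thesis unfolding * by (rule card_image)
  qed
  have "card H * card C = card (H \<times> C)" by (simp add: card_cartesian_product)
  also have "\<dots> = (\<Sum>z \<in> ?f ` (H \<times> C). card {p \<in> H \<times> C. ?f p = z})"
    using fin card_eq_sum[of "H \<times> C"] sum.image_gen[of "H \<times> C" "\<lambda>_. 1::nat" ?f] by simp
  also have "\<dots> = card ((H #> y) <#> C) * card ?D"
    using fibre by (simp add: im)
  finally show ?thesis by simp
qed

lemma card_set_mult:
  assumes "finite (carrier G)" "subgroup H G" "subgroup K G"
  shows "card (H <#> K) * card (H \<inter> K) = card H * card K"
proof -
  interpret H: subgroup H G by fact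
  interpret K: subgroup K G by fact
  have "{c \<in> K. \<one> \<otimes> c \<otimes> inv \<one> \<in> H} = H \<inter> K" by auto
  then show ?thesis
    using card_double_coset[OF assms one_closed] H.subset by simp
qed

lemma card_subgroup_pos:
  assumes "finite (carrier G)" "subgroup H G"
  shows "card H > 0"
  using finite_subset[OF subgroup.subset[OF assms(2)] assms(1)] subgroup.one_closed[OF assms(2)]
  by (auto simp: card_gt_0_iff)

lemma card_set_mult_commute:
  assumes "finite (carrier G)" "subgroup K G" "subgroup L G"
  shows "card (K <#> L) = card (L <#> K)"
proof -
  have "card (K <#> L) * card (K \<inter> L) = card (L <#> K) * card (K \<inter> L)"
    using card_set_mult[OF assms] card_set_mult[OF assms(1,3,2)]
    by (simp add: Int_commute mult.commute)
  then show ?thesis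
    using card_subgroup_pos[OF assms(1) subgroups_Inter_pair[OF assms(2,3)]] by simp
qed

lemma card_subgroup_dvd:
  assumes "finite (carrier G)" "subgroup H G" "subgroup K G" "H \<subseteq> K"
  shows "card H dvd card K"
proof -
  interpret K: group "G\<lparr>carrier := K\<rparr>" by (rule subgroup_imp_group) fact
  have "subgroup H (G\<lparr>carrier := K\<rparr>)"
    using assms subgroup_incl by blast
  from K.lagrange[OF this] have "card (rcosets\<^bsub>G\<lparr>carrier := K\<rparr>\<^esub> H) * card H = card K"
    by (simp add: order_def)
  then show ?thesis by (metis dvd_triv_right)
qed

lemma subset_set_mult:
  assumes "subgroup K G" "subgroup L G"
  shows "K \<subseteq> K <#> L" "L \<subseteq> K <#> L"
proof -
  interpret K: subgroup K G by fact
  interpret L: subgroup L G by fact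
  show "K \<subseteq> K <#> L"
  proof
    fix k assume "k \<in> K" then have "k = k \<otimes> \<one>" by simp
    then show "k \<in> K <#> L" using \<open>k \<in> K\<close> L.one_closed unfolding mem_set_mult by blast
  qed
  show "L \<subseteq> K <#> L"
  proof
    fix k assume "k \<in> L" then have "k = \<one> \<otimes> k" by simp
    then show "k \<in> K <#> L" using \<open>k \<in> L\<close> K.one_closed unfolding mem_set_mult by blast
  qed
qed

lemma set_mult_commute_subgroup:
  assumes "subgroup K G" "subgroup L G" "K <#> L = L <#> K"
  shows "subgroup (K <#> L) G"
proof (rule subgroupI)
  interpret K: subgroup K G by fact
  interpret L: subgroup L G by fact
  show sub: "K <#> L \<subseteq> carrier G" by (rule set_mult_closed[OF K.subset L.subset])
  show "K <#> L \<noteq> {}"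
    using K.one_closed L.one_closed unfolding set_mult_def by blast
  fix x assume x: "x \<in> K <#> L"
  then obtain k l where kl: "k \<in> K" "l \<in> L" "x = k \<otimes> l" by (auto simp: mem_set_mult)
  have "inv x = inv l \<otimes> inv k" using kl by (simp add: inv_mult_group)
  then show "inv x \<in> K <#> L"
    unfolding assms(3) using kl by (auto simp: mem_set_mult)
  fix y assume y: "y \<in> K <#> L"
  then obtain k' l' where kl': "k' \<in> K" "l' \<in> L" "y = k' \<otimes> l'" by (auto simp: mem_set_mult)
  have "l \<otimes> k' \<in> K <#> L" unfolding assms(3) using kl kl' by (auto simp: mem_set_mult)
  then obtain k'' l'' where kl'': "k'' \<in> K" "l'' \<in> L" "l \<otimes> k' = k'' \<otimes> l''"
    by (auto simp: mem_set_mult)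
  have "x \<otimes> y = k \<otimes> (l \<otimes> k') \<otimes> l'" using kl kl' by (simp add: m_assoc)
  also have "\<dots> = (k \<otimes> k'') \<otimes> (l'' \<otimes> l')"
    unfolding kl''(3) using kl kl' kl'' by (simp add: m_assoc)
  finally show "x \<otimes> y \<in> K <#> L" using kl kl' kl'' by (auto simp: mem_set_mult)
qed

lemma set_mult_commute_of_subgroup:
  assumes "subgroup K G" "subgroup L G" "subgroup (K <#> L) G"
  shows "L <#> K = K <#> L"
proof -
  interpret K: subgroup K G by fact
  interpret L: subgroup L G by fact
  interpret KL: subgroup "K <#> L" G by fact
  have 1: "l \<otimes> k \<in> K <#> L" if "l \<in> L" "k \<in> K" for l k
    using that subset_set_mult[OF assms(1,2)] by auto
  have 2: "k \<otimes> l \<in> L <#> K" if "l \<in> L" "k \<in> K" for l k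
  proof -
    have "k \<otimes> l \<in> K <#> L" using that by (auto simp: mem_set_mult)
    then have "inv (k \<otimes> l) \<in> K <#> L" by (rule KL.m_inv_closed)
    then obtain k' l' where kl: "k' \<in> K" "l' \<in> L" "inv (k \<otimes> l) = k' \<otimes> l'" by (auto simp: mem_set_mult)
    have "k \<otimes> l = inv (inv (k \<otimes> l))" using that by simp
    also have "\<dots> = inv l' \<otimes> inv k'" unfolding kl(3) using kl by (simp add: inv_mult_group)
    finally show ?thesis using kl by (auto simp: mem_set_mult)
  qed
  show ?thesis
  proof
    show "L <#> K \<subseteq> K <#> L" using 1 by (auto simp: mem_set_mult[of _ G L])
    show "K <#> L \<subseteq> L <#> K" using 2 by (auto simp: mem_set_mult[of _ G K])
  qed
qed

text \<open>Dedekind's modular law, in the case where the product \<open>H <#> C\<close> need not be a subgroup.\<close>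

lemma set_mult_inter_of_subset:
  assumes "subgroup H G" "subgroup K G" "subgroup C G" "H \<subseteq> K" "K \<subseteq> H <#> C"
  shows "K = H <#> (K \<inter> C)"
proof
  interpret H: subgroup H G by fact
  interpret K: subgroup K G by fact
  interpret C: subgroup C G by fact
  show "K \<subseteq> H <#> (K \<inter> C)"
  proof
    fix k assume k: "k \<in> K"
    then obtain h c where hc: "h \<in> H" "c \<in> C" "k = h \<otimes> c"
      using assms(5) unfolding subset_iff mem_set_mult by blast
    have "c = inv h \<otimes> k" using hc by simp
    then have "c \<in> K" using k subsetD[OF assms(4) hc(1)] by simp
    then show "k \<in> H <#> (K \<inter> C)" using hc by (auto simp: mem_set_mult)
  qed
  show "H <#> (K \<inter> C) \<subseteq> K" by (auto simp: mem_set_mult subsetD[OF assms(4)])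
qed

lemma subgroup_of_update_iff:
  assumes "subgroup A G"
  shows "subgroup K (G\<lparr>carrier := A\<rparr>) \<longleftrightarrow> subgroup K G \<and> K \<subseteq> A"
proof
  assume K: "subgroup K (G\<lparr>carrier := A\<rparr>)"
  show "subgroup K G \<and> K \<subseteq> A" using incl_subgroup[OF assms K] subgroup.subset[OF K] by simp
next
  assume "subgroup K G \<and> K \<subseteq> A"
  then show "subgroup K (G\<lparr>carrier := A\<rparr>)" using subgroup_incl assms by blast
qed

lemma maximal_subgroup_generate:
  assumes "maximal_subgroup B G" "subgroup K G" "\<not> K \<subseteq> B"
  shows "generate G (K \<union> B) = carrier G"
proof -
  have B: "subgroup B G" using assms(1) by (simp add: maximal_subgroup_def)
  have KB: "K \<union> B \<subseteq> carrier G" using assms(2) B subgroup.subset by blast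
  have "B \<subseteq> generate G (K \<union> B)" "K \<subseteq> generate G (K \<union> B)" by (auto intro: generate.incl)
  then show ?thesis
    using assms generate_is_subgroup[OF KB] unfolding maximal_subgroup_def by blast
qed

lemma set_mult_eq_carrier_of_maximal:
  assumes "maximal_subgroup B G" "subgroup K G" "\<not> K \<subseteq> B" "subgroup (K <#> B) G"
  shows "K <#> B = carrier G"
proof -
  have B: "subgroup B G" using assms(1) by (simp add: maximal_subgroup_def)
  show ?thesis
    using assms subset_set_mult[OF assms(2) B] unfolding maximal_subgroup_def by blast
qed

section \<open>Cyclic subgroups and cores\<close>

lemma generate_singleton_comm:
  assumes "g \<in> carrier G" "x \<in> generate G {g}" "y \<in> generate G {g}"
  shows "x \<otimes> y = y \<otimes> x"
  using assms by (auto simp: generate_pow int_pow_mult[symmetric] add.commute)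

text \<open>The property that sets cyclic groups apart from abelian ones here: it lets a count decide that two subgroups
  of \<open>\<langle>g\<rangle>\<close> coincide, as \<open>set_mult_subgroup_of_intransitive\<close> requires.\<close>

lemma cyclic_subgroups_of_same_card:
  assumes "finite (carrier G)" "g \<in> carrier G"
    and D: "subgroup D G" "D \<subseteq> generate G {g}"
    and E: "subgroup E G" "E \<subseteq> generate G {g}"
    and "card D = card E"
  shows "D = E"
proof -
  let ?C = "generate G {g}"
  have C: "subgroup ?C G" using assms(2) by (simp add: generate_is_subgroup)
  let ?n = "ord g"
  have n: "card ?C = ?n" using generate_pow_card assms(2) by simp
  have npos: "?n > 0" using card_subgroup_pos[OF assms(1) C] n by simp
  \<comment> \<open>The equation \<open>x [^] e = \<one>\<close> has at most \<open>e\<close> solutions in a cyclic group of order divisible by \<open>e\<close>,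
    so a subgroup of order \<open>e\<close> consists of all of them.\<close>
  have key: "D = {x \<in> ?C. x [^] card D = \<one>}"
    if "subgroup D G" "D \<subseteq> ?C" for D
  proof (rule card_subset_eq)
    let ?T = "{x \<in> ?C. x [^] card D = \<one>}"
    show "finite ?T" using finite_subset[OF subgroup.subset[OF C] assms(1)] by simp
    interpret D: group "G\<lparr>carrier := D\<rparr>" by (rule subgroup_imp_group) fact
    show sub: "D \<subseteq> ?T"
    proof
      fix x assume x: "x \<in> D"
      have "x [^]\<^bsub>G\<lparr>carrier := D\<rparr>\<^esub> order (G\<lparr>carrier := D\<rparr>) = \<one>"
        using D.pow_order_eq_1[of x] x by simp
      then show "x \<in> ?T"
        using that x by (auto simp: order_def nat_pow_consistent[symmetric])
    qed
    have dvd: "card D dvd ?n"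
      using card_subgroup_dvd[OF assms(1) that(1) C that(2)] n by simp
    then obtain q where q: "?n = card D * q" by blast
    have qpos: "q > 0" using q npos by (metis gr0I mult_0_right)
    have "?T \<subseteq> (\<lambda>i. g [^] (q * i)) ` {..<card D}"
    proof
      fix x assume x: "x \<in> ?T"
      then obtain k :: nat where k: "x = g [^] k"
        using generate_pow_on_finite_carrier[OF assms(1,2)] by blast
      have xk: "x = g [^] (k mod ?n)"
      proof -
        have "g [^] k = g [^] (?n * (k div ?n)) \<otimes> g [^] (k mod ?n)"
          using assms(2) by (simp add: nat_pow_mult)
        moreover have "g [^] (?n * (k div ?n)) = \<one>" using assms(2) by (simp add: pow_eq_id)
        ultimately show ?thesis using k assms(2) by simp
      qed
      have "g [^] (k * card D) = \<one>"
        using x k assms(2) by (simp add: nat_pow_pow)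
      then have "?n dvd k * card D" using assms(2) pow_eq_id by blast
      then have "q dvd k"
        using card_subgroup_pos[OF assms(1) that(1)] unfolding q by (simp add: mult.commute)
      then have "q dvd k mod ?n" using q by (simp add: dvd_mod)
      then obtain i where i: "k mod ?n = q * i" by blast
      have "k mod ?n < card D * q" using npos q by (metis mod_less_divisor)
      then have "i < card D" using i qpos by (simp add: mult.commute)
      with xk i show "x \<in> (\<lambda>i. g [^] (q * i)) ` {..<card D}" by auto
    qed
    then have "card ?T \<le> card D"
      using surj_card_le[of "{..<card D}"] by simp
    moreover have "card D \<le> card ?T" using sub \<open>finite ?T\<close> by (rule card_mono[rotated])
    ultimately show "card D = card ?T" by simp
  qed
  show ?thesis using key[OF D] key[OF E] assms(7) by simp
qed

text \<open>Read \<open>K <#> \<langle>g\<rangle> = G\<close> as transitivity of \<open>\<langle>g\<rangle>\<close> on the cosets of \<open>K\<close>.  An element of a transitive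
  abelian group that fixes one point fixes every point.\<close>

lemma conj_mem_iff_of_transitive:
  assumes "g \<in> carrier G" "subgroup K G" "K <#> generate G {g} = carrier G"
    and c: "c \<in> generate G {g}" and y: "y \<in> carrier G"
  shows "y \<otimes> c \<otimes> inv y \<in> K \<longleftrightarrow> c \<in> K"
proof -
  interpret K: subgroup K G by fact
  have C: "generate G {g} \<subseteq> carrier G" using assms(1) by (simp add: generate_incl)
  obtain k d where kd: "k \<in> K" "d \<in> generate G {g}" "y = k \<otimes> d"
    using y unfolding assms(3)[symmetric] mem_set_mult by blast
  then have dc: "d \<in> carrier G" "k \<in> carrier G" "c \<in> carrier G" using C c by auto
  have "y \<otimes> c \<otimes> inv y = k \<otimes> (d \<otimes> c) \<otimes> inv (k \<otimes> d)"
    using kd(3) dc by (simp add: m_assoc)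
  also have "\<dots> = k \<otimes> (c \<otimes> d) \<otimes> inv (k \<otimes> d)"
    using generate_singleton_comm[OF assms(1) kd(2) c] by simp
  also have "\<dots> = k \<otimes> c \<otimes> inv k"
    using dc by (simp add: m_assoc inv_mult_group)
  finally have e: "y \<otimes> c \<otimes> inv y = k \<otimes> c \<otimes> inv k" .
  show ?thesis
  proof
    assume "y \<otimes> c \<otimes> inv y \<in> K"
    then have "inv k \<otimes> (k \<otimes> c \<otimes> inv k) \<otimes> k \<in> K" using kd(1) e by simp
    then show "c \<in> K" using dc by (simp add: m_assoc)
  qed (use e kd(1) in simp)
qed

text \<open>The greatest normal subgroup inside \<open>K\<close> is the intersection of the conjugates of \<open>K\<close>.\<close>

lemma mem_normal_core_iff:
  assumes "subgroup K G"
  shows "x \<in> normal_core G K \<longleftrightarrow> x \<in> carrier G \<and> (\<forall>y \<in> carrier G. y \<otimes> x \<otimes> inv y \<in> K)"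
proof -
  interpret K: subgroup K G by fact
  let ?M = "{x \<in> carrier G. \<forall>y \<in> carrier G. y \<otimes> x \<otimes> inv y \<in> K}"
  note core = normal_core_greatest[OF assms]
  interpret N: normal "normal_core G K" G by (rule core)
  have "?M \<lhd> G"
  proof (rule normal_invI)
    show "subgroup ?M G"
    proof (rule subgroupI)
      have "\<one> \<in> ?M" by simp
      then show "?M \<noteq> {}" by blast
      fix a assume a: "a \<in> ?M"
      have "y \<otimes> inv a \<otimes> inv y = inv (y \<otimes> a \<otimes> inv y)" if "y \<in> carrier G" for y
        using a that by (simp add: inv_mult_group m_assoc)
      then show "inv a \<in> ?M" using a by auto
      fix b assume b: "b \<in> ?M"
      have "y \<otimes> (a \<otimes> b) \<otimes> inv y = (y \<otimes> a \<otimes> inv y) \<otimes> (y \<otimes> b \<otimes> inv y)"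
        if "y \<in> carrier G" for y
        using a b that by (simp add: m_assoc)
      then show "a \<otimes> b \<in> ?M" using a b by auto
    qed auto
    fix x h assume x: "x \<in> carrier G" and h: "h \<in> ?M"
    have "y \<otimes> (x \<otimes> h \<otimes> inv x) \<otimes> inv y = (y \<otimes> x) \<otimes> h \<otimes> inv (y \<otimes> x)" if "y \<in> carrier G" for y
      using that x h by (simp add: inv_mult_group m_assoc)
    then show "x \<otimes> h \<otimes> inv x \<in> ?M" using x h by auto
  qed
  moreover have "?M \<subseteq> K"
  proof
    fix x assume "x \<in> ?M"
    then have "\<one> \<otimes> x \<otimes> inv \<one> \<in> K" "x \<in> carrier G" by blast+
    then show "x \<in> K" by simp
  qed
  ultimately have "?M \<subseteq> normal_core G K" by (rule core(3))
  moreover have "normal_core G K \<subseteq> ?M"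
    using N.subset N.inv_op_closed2 core(2) by blast
  ultimately show ?thesis by blast
qed

text \<open>The core of \<open>K\<close> is the kernel of the action on its cosets, and a point stabilizer of the transitive
  abelian group \<open>\<langle>g\<rangle>\<close> acts trivially.\<close>

lemma inter_cyclic_subset_normal_core:
  assumes "g \<in> carrier G" "subgroup K G" "K <#> generate G {g} = carrier G"
  shows "K \<inter> generate G {g} \<subseteq> normal_core G K"
  using conj_mem_iff_of_transitive[OF assms] subgroup.mem_carrier[OF assms(2)]
  by (auto simp: mem_normal_core_iff[OF assms(2)])

text \<open>Ritt's argument: both subgroups are \<open>H\<close> times a subgroup of the abelian group \<open>\<langle>g\<rangle>\<close>, and the factors from
  \<open>\<langle>g\<rangle>\<close> can be interchanged.\<close>

lemma set_mult_subgroup_of_transitive: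
  assumes "g \<in> carrier G" and H: "subgroup H G" "H <#> generate G {g} = carrier G"
    and K: "subgroup K G" "H \<subseteq> K" and L: "subgroup L G" "H \<subseteq> L"
  shows "subgroup (K <#> L) G"
proof -
  let ?C = "generate G {g}"
  have C: "subgroup ?C G" using assms(1) by (simp add: generate_is_subgroup)
  have sub: "P <#> Q \<subseteq> Q <#> P"
    if P: "subgroup P G" "H \<subseteq> P" and Q: "subgroup Q G" "H \<subseteq> Q" for P Q
  proof
    interpret H: subgroup H G by fact
    interpret P: subgroup P G by fact
    interpret Q: subgroup Q G by fact
    interpret C: subgroup ?C G by fact
    \<comment> \<open>Take inverses in \<open>Z = H <#> (Z \<inter> C)\<close>, to have the factor from \<open>C\<close> on the left.\<close>
    have split: "\<exists>c \<in> Z \<inter> ?C. \<exists>h \<in> H. z = c \<otimes> h" if Z: "subgroup Z G" "H \<subseteq> Z" "z \<in> Z" for Z z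
    proof -
      interpret Z: subgroup Z G by fact
      have "inv z \<in> H <#> (Z \<inter> ?C)"
        using set_mult_inter_of_subset[OF H(1) Z(1) C Z(2)] Z.subset Z(3) H(2) by simp
      then obtain h c where hc: "h \<in> H" "c \<in> Z \<inter> ?C" "inv z = h \<otimes> c"
        by (auto simp: mem_set_mult)
      have "z = inv (inv z)" using Z(3) by simp
      also have "\<dots> = inv c \<otimes> inv h" unfolding hc(3) using hc by (simp add: inv_mult_group)
      finally show ?thesis using hc by auto
    qed
    fix z assume "z \<in> P <#> Q"
    then obtain x y where xy: "x \<in> P" "y \<in> Q" "z = x \<otimes> y" by (auto simp: mem_set_mult)
    obtain c h where ch: "c \<in> P \<inter> ?C" "h \<in> H" "x = c \<otimes> h" using split[OF P xy(1)] by blast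
    have "h \<otimes> y \<in> Q" using ch xy Q by auto
    then obtain d k where dk: "d \<in> Q \<inter> ?C" "k \<in> H" "h \<otimes> y = d \<otimes> k" using split[OF Q] by blast
    have "z = c \<otimes> (h \<otimes> y)" using xy ch by (simp add: m_assoc)
    also have "\<dots> = (c \<otimes> d) \<otimes> k" unfolding dk(3) using ch dk by (simp add: m_assoc)
    also have "\<dots> = d \<otimes> (c \<otimes> k)"
      using generate_singleton_comm[OF assms(1), of c d] ch dk by (simp add: m_assoc)
    finally show "z \<in> Q <#> P" using ch dk P(2) by (auto simp: mem_set_mult)
  qed
  have "K <#> L = L <#> K" using sub[OF K L] sub[OF L K] by blast
  then show ?thesis by (rule set_mult_commute_subgroup[OF K(1) L(1)])
qed

section \<open>Subgroups of index two\<close>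

lemma index_two_coset:
  assumes "finite (carrier G)" "subgroup N G" "subgroup P G" "N \<subseteq> P" "card P = 2 * card N"
    and p: "p \<in> P" "p \<notin> N"
  shows "P = N \<union> (N #> p)" "N \<inter> (N #> p) = {}"
proof -
  interpret N: subgroup N G by fact
  interpret P: subgroup P G by fact
  have fin: "finite P" using finite_subset[OF P.subset assms(1)] .
  have inj: "inj_on (\<lambda>x. x \<otimes> p) N" using p by (intro inj_onI) auto
  have "N #> p = (\<lambda>x. x \<otimes> p) ` N" by (auto simp: r_coset_def)
  then have c: "card (N #> p) = card N" using card_image[OF inj] by simp
  show disj: "N \<inter> (N #> p) = {}"
  proof (rule ccontr)
    assume "N \<inter> (N #> p) \<noteq> {}"
    then obtain n where n: "n \<in> N" "n \<otimes> p \<in> N" by (auto simp: mem_r_coset)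
    then have "inv n \<otimes> (n \<otimes> p) \<in> N" by blast
    then show False using n p by simp
  qed
  have sub: "N \<union> (N #> p) \<subseteq> P"
    using assms(4) p by (auto simp: mem_r_coset subsetD[OF assms(4)])
  have "card (N \<union> (N #> p)) = card P"
    using card_Un_disjoint[OF _ _ disj] finite_subset[OF sub fin] c assms(5) by simp
  then show "P = N \<union> (N #> p)" using card_subset_eq[OF fin sub] by simp
qed

lemma index_two_square:
  assumes "finite (carrier G)" "subgroup N G" "subgroup P G" "N \<subseteq> P" "card P = 2 * card N"
    and p: "p \<in> P" "p \<notin> N"
  shows "p \<otimes> p \<in> N"
proof (rule ccontr)
  interpret N: subgroup N G by fact
  interpret P: subgroup P G by fact
  assume "p \<otimes> p \<notin> N"
  then have "p \<otimes> p \<in> N #> p" using index_two_coset[OF assms] p P.m_closed by blast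
  then obtain n where "n \<in> N" "p \<otimes> p = n \<otimes> p" by (auto simp: mem_r_coset)
  then show False using p by auto
qed

lemma index_two_conj:
  assumes "finite (carrier G)" "subgroup N G" "subgroup P G" "N \<subseteq> P" "card P = 2 * card N"
    and p: "p \<in> P" and h: "h \<in> N"
  shows "p \<otimes> h \<otimes> inv p \<in> N"
proof (cases "p \<in> N")
  interpret N: subgroup N G by fact
  interpret P: subgroup P G by fact
  case False
  show ?thesis
  proof (rule ccontr)
    assume "p \<otimes> h \<otimes> inv p \<notin> N"
    moreover have "p \<otimes> h \<otimes> inv p \<in> P" using p subsetD[OF assms(4) h] by simp
    ultimately have "p \<otimes> h \<otimes> inv p \<in> N #> p" using index_two_coset[OF assms(1-6) False] by blast
    then obtain n where n: "n \<in> N" "p \<otimes> h \<otimes> inv p = n \<otimes> p" by (auto simp: mem_r_coset)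
    have "p = (p \<otimes> h \<otimes> inv p) \<otimes> p \<otimes> inv h" using p h by (simp add: m_assoc)
    also have "\<dots> = n \<otimes> (p \<otimes> p) \<otimes> inv h" unfolding n(2) using n p h by (simp add: m_assoc)
    also have "\<dots> \<in> N" using index_two_square[OF assms(1-6) False] n h by simp
    finally show False using False by simp
  qed
next
  interpret N: subgroup N G by fact
  case True then show ?thesis using h by simp
qed

text \<open>A subgroup of index two is normal, so \<open>N\<close> is normalized by \<open>P\<close> and by \<open>Q\<close>.\<close>

lemma index_two_both_normal:
  assumes fin: "finite (carrier G)" and N: "subgroup N G"
    and P: "subgroup P G" "N \<subseteq> P" "card P = 2 * card N"
    and Q: "subgroup Q G" "N \<subseteq> Q" "card Q = 2 * card N"
    and gen: "generate G (P \<union> Q) = carrier G"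
  shows "N \<lhd> G"
proof (rule normal_invI[OF N])
  interpret N: subgroup N G by fact
  interpret P: subgroup P G by fact
  interpret Q: subgroup Q G by fact
  have PQ: "P \<union> Q \<subseteq> carrier G" by auto
  fix x h assume x: "x \<in> carrier G" and h: "h \<in> N"
  have step: "x \<otimes> h \<otimes> inv x \<in> N" if "x \<in> P \<union> Q" "h \<in> N" for x h
    using that index_two_conj[OF fin N P] index_two_conj[OF fin N Q] by blast
  have "x \<in> generate G (P \<union> Q)" using x gen by simp
  then have "\<forall>h \<in> N. x \<otimes> h \<otimes> inv x \<in> N"
  proof (induction rule: generate.induct)
    case one then show ?case by simp
  next
    case (incl h) then show ?case using step by auto
  next
    case (inv h)
    then have "inv h \<in> P \<union> Q" by auto
    then show ?case using step by blast
  next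
    case (eng h1 h2)
    have c: "h1 \<in> carrier G" "h2 \<in> carrier G" using eng(1,2) gen by simp_all
    show ?case
    proof
      fix h assume h: "h \<in> N"
      have "h1 \<otimes> h2 \<otimes> h \<otimes> inv (h1 \<otimes> h2) = h1 \<otimes> (h2 \<otimes> h \<otimes> inv h2) \<otimes> inv h1"
        using c h by (simp add: m_assoc inv_mult_group)
      then show "h1 \<otimes> h2 \<otimes> h \<otimes> inv (h1 \<otimes> h2) \<in> N" using eng h by simp
    qed
  qed
  then show "x \<otimes> h \<otimes> inv x \<in> N" using h by blast
qed

section \<open>Dihedral quotients\<close>

text \<open>Two involutions generate a dihedral group whose rotations are the powers of \<open>\<rho> = s \<otimes> t\<close>, because \<open>t\<close>
  inverts \<open>\<rho>\<close>.  Every divisor \<open>d\<close> of the order of \<open>\<rho>\<close> yields an intermediate subgroup between \<open>{\<one>, t}\<close>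
  and \<open>G\<close>, so maximality leaves only prime orders.\<close>

lemma dihedral_of_involutions:
  assumes fin: "finite (carrier G)"
    and s: "s \<in> carrier G" "s \<otimes> s = \<one>"
    and t: "t \<in> carrier G" "t \<otimes> t = \<one>" "t \<noteq> \<one>"
    and max: "maximal_subgroup {\<one>, t} G" and st: "s \<notin> {\<one>, t}"
  shows "\<exists>r. Factorial_Ring.prime r \<and> order G = 2 * r \<and> G \<cong> dihedral_group r"
proof -
  define \<rho> where "\<rho> = s \<otimes> t"
  define r where "r = ord \<rho>"
  have \<rho>: "\<rho> \<in> carrier G" using s t by (simp add: \<rho>_def)
  have inv_st: "inv s = s" "inv t = t" using s t by (simp_all add: inv_equality)
  have inv_\<rho>: "inv \<rho> = t \<otimes> s" using s t inv_st by (simp add: \<rho>_def inv_mult_group)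
  have tt: "t \<otimes> (t \<otimes> x) = x" if "x \<in> carrier G" for x
    using t that by (simp flip: m_assoc)
  have rpos: "r > 0" using ord_ge_1[OF fin \<rho>] by (simp add: r_def)
  have t_inverts: "t \<otimes> \<rho> [^] (i::int) = \<rho> [^] (- i) \<otimes> t" for i
  proof -
    have "t \<otimes> \<rho> = inv \<rho> \<otimes> t"
      unfolding inv_\<rho> using s t by (simp add: \<rho>_def m_assoc)
    then have nat: "t \<otimes> \<rho> [^] n = inv \<rho> [^] n \<otimes> t" for n :: nat
    proof (induction n)
      case (Suc n)
      have "t \<otimes> \<rho> [^] Suc n = (t \<otimes> \<rho> [^] n) \<otimes> \<rho>" using t \<rho> by (simp add: m_assoc)
      also have "\<dots> = inv \<rho> [^] n \<otimes> (t \<otimes> \<rho>)" using Suc t \<rho> by (simp add: m_assoc)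
      also have "\<dots> = inv \<rho> [^] Suc n \<otimes> t" unfolding Suc.prems using t \<rho> by (simp add: m_assoc)
      finally show ?case .
    qed (use t in simp)
    have "t \<otimes> inv \<rho> = \<rho> \<otimes> t"
      unfolding inv_\<rho> using s t tt by (simp add: \<rho>_def m_assoc)
    then have nat': "t \<otimes> inv \<rho> [^] n = \<rho> [^] n \<otimes> t" for n :: nat
    proof (induction n)
      case (Suc n)
      have "t \<otimes> inv \<rho> [^] Suc n = (t \<otimes> inv \<rho> [^] n) \<otimes> inv \<rho>" using t \<rho> by (simp add: m_assoc)
      also have "\<dots> = \<rho> [^] n \<otimes> (t \<otimes> inv \<rho>)" using Suc t \<rho> by (simp add: m_assoc)
      also have "\<dots> = \<rho> [^] Suc n \<otimes> t" unfolding Suc.prems using t \<rho> by (simp add: m_assoc)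
      finally show ?case .
    qed (use t in simp)
    show ?thesis
      using nat nat' \<rho> by (cases i rule: int_cases2) (simp_all add: int_pow_int int_pow_neg nat_pow_inv)
  qed
  \<comment> \<open>The subgroup generated by \<open>\<rho> [^] d\<close> and \<open>t\<close>.  For \<open>d = 1\<close> it contains \<open>s\<close>, so maximality of
    \<open>{\<one>, t}\<close> makes it all of \<open>G\<close>; for a divisor \<open>d\<close> of \<open>r\<close>, maximality makes it \<open>{\<one>, t}\<close> or everything,
    which is what forces \<open>r\<close> to be prime.\<close>
  let ?S = "\<lambda>d::int. {\<rho> [^] (d * i) | i. True} \<union> {\<rho> [^] (d * i) \<otimes> t | i. True}"
  have S: "subgroup (?S d) G" for d
  proof (rule subgroupI)
    show "?S d \<subseteq> carrier G" using \<rho> t by auto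
    show "?S d \<noteq> {}" by blast
    fix x assume x: "x \<in> ?S d"
    then consider i where "x = \<rho> [^] (d * i)" | i where "x = \<rho> [^] (d * i) \<otimes> t" by blast
    note xc = this
    show "inv x \<in> ?S d"
    proof (cases rule: xc)
      case (1 i)
      then have "inv x = \<rho> [^] (d * (- i))" using \<rho> by (simp add: int_pow_neg)
      then show ?thesis by blast
    next
      case (2 i)
      then have "inv x = t \<otimes> \<rho> [^] (d * (- i))" using \<rho> t inv_st by (simp add: inv_mult_group int_pow_neg)
      also have "\<dots> = \<rho> [^] (d * i) \<otimes> t" by (simp add: t_inverts)
      finally show ?thesis by blast
    qed
    fix y assume y: "y \<in> ?S d"
    then consider i where "y = \<rho> [^] (d * i)" | i where "y = \<rho> [^] (d * i) \<otimes> t" by blast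
    note yc = this
    show "x \<otimes> y \<in> ?S d"
    proof (cases rule: xc)
      case x1: (1 i)
      show ?thesis
      proof (cases rule: yc)
        case (1 j)
        then have "x \<otimes> y = \<rho> [^] (d * (i + j))" using x1 \<rho> by (simp add: int_pow_mult distrib_left)
        then show ?thesis by blast
      next
        case (2 j)
        then have "x \<otimes> y = \<rho> [^] (d * (i + j)) \<otimes> t"
          using x1 \<rho> t by (simp add: int_pow_mult distrib_left m_assoc)
        then show ?thesis by blast
      qed
    next
      case x2: (2 i)
      show ?thesis
      proof (cases rule: yc)
        case (1 j)
        have "x \<otimes> y = \<rho> [^] (d * i) \<otimes> (t \<otimes> \<rho> [^] (d * j))"
          using x2 1 \<rho> t by (simp add: m_assoc)
        also have "\<dots> = \<rho> [^] (d * i) \<otimes> \<rho> [^] (d * - j) \<otimes> t"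
          unfolding t_inverts using \<rho> t by (simp add: m_assoc)
        also have "\<dots> = \<rho> [^] (d * (i - j)) \<otimes> t"
          using \<rho> by (simp add: int_pow_mult[symmetric] right_diff_distrib)
        finally show ?thesis by blast
      next
        case (2 j)
        have "x \<otimes> y = \<rho> [^] (d * i) \<otimes> (t \<otimes> \<rho> [^] (d * j)) \<otimes> t"
          using x2 2 \<rho> t by (simp add: m_assoc)
        also have "\<dots> = \<rho> [^] (d * i) \<otimes> \<rho> [^] (d * - j)"
          unfolding t_inverts using \<rho> t by (simp add: m_assoc)
        also have "\<dots> = \<rho> [^] (d * (i - j))"
          using \<rho> by (simp add: int_pow_mult[symmetric] right_diff_distrib)
        finally show ?thesis by blast
      qed
    qed
  qed
  have St: "{\<one>, t} \<subseteq> ?S d" for d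
  proof -
    have "\<one> = \<rho> [^] (d * 0)" "t = \<rho> [^] (d * 0) \<otimes> t" using t by simp_all
    then show ?thesis by blast
  qed
  have S_cases: "?S d = {\<one>, t} \<or> ?S d = carrier G" for d
    using max S St unfolding maximal_subgroup_def by blast
  have s_eq: "s = \<rho> [^] (1 * 1 :: int) \<otimes> t"
    using s t by (simp add: \<rho>_def m_assoc)
  have S1: "?S 1 = carrier G"
    using S_cases[of 1] s_eq st by blast
  \<comment> \<open>If \<open>t\<close> were a rotation, \<open>s\<close> and \<open>t\<close> would commute, so \<open>\<rho>\<close> would have order at most two,
    leaving only \<open>t = \<rho>\<close>, that is \<open>s = \<one>\<close>.\<close>
  have t_not_rot: "t \<noteq> \<rho> [^] (i::int)" for i
  proof
    assume i: "t = \<rho> [^] i"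
    have "\<rho> \<otimes> t = t \<otimes> \<rho>"
      unfolding i using \<rho> int_pow_mult[of \<rho> 1 i] int_pow_mult[of \<rho> i 1] by (simp add: add.commute)
    then have "s = t \<otimes> s \<otimes> t" using s t by (simp add: \<rho>_def m_assoc)
    then have "s \<otimes> t = t \<otimes> s" using s t by (metis m_assoc m_closed r_one)
    then have "\<rho> \<otimes> \<rho> = (s \<otimes> t) \<otimes> (t \<otimes> s)" by (simp add: \<rho>_def)
    also have "\<dots> = \<one>" using s t tt by (simp add: m_assoc)
    finally have \<rho>2: "\<rho> [^] (2::int) = \<one>" using \<rho> int_pow_mult[of \<rho> 1 1] by simp
    have "\<rho> [^] i \<in> {\<one>, \<rho>}"
    proof (cases "even i")
      case True
      then show ?thesis using \<rho> \<rho>2 by (auto simp: int_pow_pow[symmetric])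
    next
      case False
      then obtain k where "i = 2 * k + 1" by (elim oddE)
      then show ?thesis using \<rho> \<rho>2 by (auto simp: int_pow_mult int_pow_pow[symmetric])
    qed
    then have "t = \<rho>" using t i by auto
    then have "s = \<one>" using s t by (metis \<rho>_def l_cancel_one' r_cancel_one')
    then show False using st by simp
  qed
  have rot_eq: "\<rho> [^] (i::int) = \<rho> [^] j \<longleftrightarrow> i mod int r = j mod int r" for i j
    using int_pow_eq[OF \<rho>, of i j] by (metis mod_eq_dvd_iff r_def)
  have mixed: "\<rho> [^] (i::int) \<otimes> t \<noteq> \<rho> [^] (j::int)" for i j
  proof
    assume "\<rho> [^] i \<otimes> t = \<rho> [^] j"
    then have "inv (\<rho> [^] i) \<otimes> \<rho> [^] j = t" using \<rho> t by (metis int_pow_closed inv_solve_left)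
    then have "t = \<rho> [^] (- i + j)" using \<rho> int_pow_mult[of \<rho> "- i" j] by (simp add: int_pow_neg)
    then show False using t_not_rot by blast
  qed
  have prime: "Factorial_Ring.prime r"
  unfolding prime_nat_iff
  proof (intro conjI allI impI)
    have "r \<noteq> 1" using ord_eq_1[OF \<rho>] st s t inv_st unfolding r_def \<rho>_def
      by (metis insert_iff inv_equality)
    then show "1 < r" using rpos by simp
    fix d assume d: "d dvd r"
    show "d = 1 \<or> d = r"
    proof (cases "?S (int d) = carrier G")
      case True
      then have "\<rho> \<in> ?S (int d)" using \<rho> by simp
      moreover have "\<rho> \<noteq> \<rho> [^] (int d * i) \<otimes> t" for i
        using mixed[of "int d * i" 1] \<rho> by auto
      ultimately obtain i where "\<rho> = \<rho> [^] (int d * i)" by blast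
      then have "int r dvd int d * i - 1"
        using rot_eq[of 1 "int d * i"] \<rho> by (simp add: mod_eq_dvd_iff dvd_diff_commute)
      then have "int d dvd int d * i - 1" using d by (meson dvd_trans int_dvd_int_iff)
      then have "int d dvd int d * i - (int d * i - 1)" by (rule dvd_diff[OF dvd_triv_left])
      moreover have "int d * i - (int d * i - 1) = 1" by simp
      ultimately have "int d dvd 1" by (simp only:)
      then show ?thesis by simp
    next
      case False
      then have "\<rho> [^] (int d * 1) \<in> {\<one>, t}" using S_cases[of "int d"] by blast
      then have "\<rho> [^] int d = \<one>" using t_not_rot by auto
      then have "r dvd d" using pow_eq_id[OF \<rho>] by (simp add: r_def int_pow_int)
      then show ?thesis using d dvd_antisym by blast
    qed
  qed
  let ?f = "\<lambda>(a :: int, b). if b then \<rho> [^] a \<otimes> t else \<rho> [^] a"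
  have surj: "?f ` carrier (dihedral_group r) = carrier G"
  proof
    show "?f ` carrier (dihedral_group r) \<subseteq> carrier G" using \<rho> t by auto
    show "carrier G \<subseteq> ?f ` carrier (dihedral_group r)"
    proof
      fix x assume "x \<in> carrier G"
      then consider i where "x = \<rho> [^] (1 * i :: int)" | i where "x = \<rho> [^] (1 * i :: int) \<otimes> t"
        unfolding S1[symmetric] by blast
      then have "x \<in> {?f (i mod int r, b) | i b. True}"
      proof cases
        case (1 i) then have "x = ?f (i mod int r, False)" using rot_eq by simp
        then show ?thesis by blast
      next
        case (2 i) then have "x = ?f (i mod int r, True)" using rot_eq[of "i mod int r" i] by simp
        then show ?thesis by blast
      qed
      then show "x \<in> ?f ` carrier (dihedral_group r)"
        using rpos by (auto simp: dihedral_group_def)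
    qed
  qed
  have rot_inj: "i = j" if "\<rho> [^] (i::int) = \<rho> [^] j" "i \<in> {0..<int r}" "j \<in> {0..<int r}" for i j
    using that by (simp add: rot_eq)
  have inj: "inj_on ?f (carrier (dihedral_group r))"
  proof (rule inj_onI)
    fix p q assume p: "p \<in> carrier (dihedral_group r)" and q: "q \<in> carrier (dihedral_group r)"
      and e: "?f p = ?f q"
    obtain i b j c where [simp]: "p = (i, b)" "q = (j, c)" by (cases p, cases q) auto
    show "p = q"
      using p q e rot_inj \<rho> t mixed mixed[THEN not_sym]
      by (auto simp: dihedral_group_def split: if_splits)
  qed
  have hom: "?f \<in> hom (dihedral_group r) G"
  proof (rule homI)
    fix p assume "p \<in> carrier (dihedral_group r)"
    then show "?f p \<in> carrier G" using surj by blast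
  next
    fix p q assume "p \<in> carrier (dihedral_group r)" "q \<in> carrier (dihedral_group r)"
    obtain i b j c where [simp]: "p = (i, b)" "q = (j, c)" by (cases p, cases q) auto
    have plus: "\<rho> [^] ((i + j) mod int r) = \<rho> [^] i \<otimes> \<rho> [^] j"
      using rot_eq[of "(i + j) mod int r" "i + j"] \<rho> by (simp add: int_pow_mult)
    have minus: "\<rho> [^] ((i - j) mod int r) = \<rho> [^] i \<otimes> \<rho> [^] (- j)"
      using rot_eq[of "(i - j) mod int r" "i - j"] \<rho> int_pow_mult[of \<rho> i "- j"] by simp
    have swap: "\<rho> [^] i \<otimes> t \<otimes> \<rho> [^] j = \<rho> [^] i \<otimes> \<rho> [^] (- j) \<otimes> t"
      using \<rho> t t_inverts[of j] by (simp add: m_assoc)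
    show "?f (p \<otimes>\<^bsub>dihedral_group r\<^esub> q) = ?f p \<otimes> ?f q"
    proof (cases b)
      case True
      have "?f p \<otimes> ?f q = (\<rho> [^] i \<otimes> t \<otimes> \<rho> [^] j) \<otimes> (if c then t else \<one>)"
        using True \<rho> t by (simp add: m_assoc)
      also have "\<dots> = ?f (p \<otimes>\<^bsub>dihedral_group r\<^esub> q)"
        unfolding swap using True \<rho> t by (simp add: dihedral_group_def minus m_assoc)
      finally show ?thesis by simp
    next
      case False
      then show ?thesis using \<rho> t by (simp add: dihedral_group_def plus m_assoc)
    qed
  qed
  have bij: "bij_betw ?f (carrier (dihedral_group r)) (carrier G)"
    using inj surj by (simp add: bij_betw_def)
  have "?f \<in> iso (dihedral_group r) G" using hom bij by (simp add: iso_def)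
  then have "dihedral_group r \<cong> G" by (auto simp: is_iso_def)
  then have "G \<cong> dihedral_group r"
    using group.iso_sym[OF group_dihedral_group[OF rpos]] by blast
  moreover have "order G = 2 * r"
    using bij_betw_same_card[OF bij] order_dihedral_group by (simp add: order_def)
  ultimately show ?thesis using prime by blast
qed

text \<open>In the quotient by \<open>N\<close>, the images of \<open>P\<close> and \<open>Q\<close> are groups of order two, the second one maximal;
  \<open>2 * r * card N\<close> says that \<open>r\<close> is the index of \<open>Q\<close>.\<close>

lemma dihedral_quotient:
  assumes fin: "finite (carrier G)" and N: "N \<lhd> G"
    and P: "subgroup P G" "N \<subseteq> P" "card P = 2 * card N"
    and Q: "maximal_subgroup Q G" "N \<subseteq> Q" "card Q = 2 * card N" and "P \<noteq> Q"
  shows "\<exists>r. Factorial_Ring.prime r \<and> card (carrier G) = 2 * r * card N \<and> G Mod N \<cong> dihedral_group r"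
proof -
  interpret N: normal N G by fact
  interpret P: subgroup P G by fact
  have Qs: "subgroup Q G" using Q(1) by (simp add: maximal_subgroup_def)
  interpret Q: subgroup Q G by fact
  have Ns: "subgroup N G" by (rule N.subgroup_axioms)
  interpret M: group "G Mod N" by (rule N.factorgroup_is_group)
  have "card N > 0" using card_subgroup_pos[OF fin Ns] .
  then have "\<not> P \<subseteq> N" "\<not> Q \<subseteq> N"
    using P Q(2,3) by auto
  then obtain p q where p: "p \<in> P" "p \<notin> N" and q: "q \<in> Q" "q \<notin> N" by blast
  have eqN: "N #> x = N \<longleftrightarrow> x \<in> N" if "x \<in> carrier G" for x
    using that Ns coset_join1 coset_join2 N.subset by meson
  have mult: "(N #> x) <#> (N #> y) = N #> (x \<otimes> y)" if "x \<in> carrier G" "y \<in> carrier G" for x y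
    using that by (rule N.rcos_sum)
  have carr: "N #> x \<in> carrier (G Mod N)" if "x \<in> carrier G" for x
    using that by (auto simp: carrier_FactGroup)
  have pq: "p \<in> carrier G" "q \<in> carrier G" using p q by auto
  have QN: "(\<lambda>x. N #> x) ` Q = {N, N #> q}"
  proof
    show "(\<lambda>x. N #> x) ` Q \<subseteq> {N, N #> q}"
    proof
      fix T assume "T \<in> (\<lambda>x. N #> x) ` Q"
      then obtain x where x: "x \<in> Q" "T = N #> x" by blast
      then have "x \<in> N \<or> x \<in> N #> q"
        using index_two_coset(1)[OF fin Ns Qs Q(2,3) q] by blast
      then show "T \<in> {N, N #> q}"
        using x eqN repr_independence[of x N q] pq Ns by auto
    qed
    show "{N, N #> q} \<subseteq> (\<lambda>x. N #> x) ` Q"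
      using eqN[of \<one>] N.one_closed Q.one_closed q(1) by (metis empty_subsetI imageI insert_subset one_closed)
  qed
  have max: "maximal_subgroup {N, N #> q} (G Mod N)"
    unfolding maximal_subgroup_def
  proof (intro conjI allI impI)
    have hom: "group_hom G (G Mod N) (\<lambda>x. N #> x)"
      using N.r_coset_hom_Mod by (simp add: group_hom_def group_hom_axioms_def is_group M.is_group)
    show "subgroup {N, N #> q} (G Mod N)"
      using group_hom.subgroup_img_is_subgroup[OF hom Qs] by (simp add: QN)
    have preim: "x \<in> Q" if "N #> x \<in> {N, N #> q}" "x \<in> carrier G" for x
    proof -
      have "N #> x \<in> (\<lambda>x. N #> x) ` Q" using that QN by simp
      then obtain y where y: "y \<in> Q" "N #> x = N #> y" by blast
      have "x \<in> N #> x" using that Ns rcos_self by simp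
      then obtain n where "n \<in> N" "x = n \<otimes> y" using y by (auto simp: mem_r_coset)
      then show ?thesis using y Q(2) by auto
    qed
    show "{N, N #> q} \<noteq> carrier (G Mod N)"
    proof
      assume e: "{N, N #> q} = carrier (G Mod N)"
      have "x \<in> Q" if "x \<in> carrier G" for x
        by (rule preim[OF _ that]) (unfold e, rule carr[OF that])
      then have "Q = carrier G" using Q.subset by blast
      then show False using Q(1) by (simp add: maximal_subgroup_def)
    qed
    fix T assume T: "subgroup T (G Mod N)" "{N, N #> q} \<subseteq> T"
    let ?T = "{x \<in> carrier G. N #> x \<in> T}"
    interpret T: subgroup T "G Mod N" by fact
    have "subgroup ?T G"
    proof (rule subgroupI)
      show "?T \<noteq> {}" using T(2) pq by blast
      fix a assume a: "a \<in> ?T"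
      have "inv\<^bsub>G Mod N\<^esub> (N #> a) = N #> inv a"
        using a group_hom.hom_inv[OF hom, of a] by simp
      then show "inv a \<in> ?T" using a T.m_inv_closed[of "N #> a"] by simp
      fix b assume b: "b \<in> ?T"
      show "a \<otimes> b \<in> ?T" using a b T.m_closed[of "N #> a" "N #> b"] mult by simp
    qed auto
    moreover have "Q \<subseteq> ?T"
    proof
      fix x assume "x \<in> Q"
      then have "N #> x \<in> T" using T(2) unfolding QN[symmetric] by blast
      then show "x \<in> ?T" using \<open>x \<in> Q\<close> by simp
    qed
    ultimately have "?T = Q \<or> ?T = carrier G" using Q(1) by (simp add: maximal_subgroup_def)
    then have "(\<lambda>x. N #> x) ` ?T = {N, N #> q} \<or> (\<lambda>x. N #> x) ` ?T = carrier (G Mod N)"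
      unfolding QN[symmetric] carrier_FactGroup by metis
    moreover have "(\<lambda>x. N #> x) ` ?T = T"
      using T.subset by (auto simp: carrier_FactGroup)
    ultimately show "T = {N, N #> q} \<or> T = carrier (G Mod N)" by simp
  qed
  have finM: "finite (carrier (G Mod N))" using fin by (simp add: carrier_FactGroup)
  have sq: "(N #> x) \<otimes>\<^bsub>G Mod N\<^esub> (N #> x) = \<one>\<^bsub>G Mod N\<^esub>"
    if "subgroup R G" "N \<subseteq> R" "card R = 2 * card N" "x \<in> R" "x \<notin> N" for R x
    using index_two_square[OF fin Ns that] subgroup.mem_carrier[OF that(1,4)] mult eqN by simp
  have ne: "N #> q \<noteq> N" "N #> p \<noteq> N" using eqN pq p q by auto
  have "N #> p \<noteq> N #> q"
  proof
    assume "N #> p = N #> q"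
    then have "P = Q"
      using index_two_coset(1)[OF fin Ns P p] index_two_coset(1)[OF fin Ns Qs Q(2,3) q] by simp
    then show False using \<open>P \<noteq> Q\<close> by simp
  qed
  with ne have st: "N #> p \<notin> {\<one>\<^bsub>G Mod N\<^esub>, N #> q}" by simp
  have max': "maximal_subgroup {\<one>\<^bsub>G Mod N\<^esub>, N #> q} (G Mod N)" using max by simp
  have q1: "N #> q \<noteq> \<one>\<^bsub>G Mod N\<^esub>" using ne by simp
  obtain r where r: "Factorial_Ring.prime r" "order (G Mod N) = 2 * r" "G Mod N \<cong> dihedral_group r"
    using M.dihedral_of_involutions[OF finM carr[OF pq(1)] sq[OF P p] carr[OF pq(2)]
        sq[OF Qs Q(2,3) q] q1 max' st] by blast
  have "card (carrier G) = 2 * r * card N"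
    using lagrange[OF Ns] r(2) by (simp add: order_def FactGroup_def)
  then show ?thesis using r by blast
qed

end

section \<open>Cyclic groups with at most two double cosets\<close>

text \<open>At most two double cosets \<open>H x \<langle>g\<rangle>\<close>, one of which is \<open>H \<langle>g\<rangle>\<close> itself; the second one may be missing.
  These double cosets correspond to the cycles of \<open>g\<close> on the cosets of \<open>H\<close>.  The formulation passes to every
  overgroup of \<open>H\<close>, which lets the locale be interpreted again for such overgroups.\<close>

locale two_double_cosets = group G for G (structure) +
  fixes g H
  assumes finite_carrier: "finite (carrier G)"
    and g_closed: "g \<in> carrier G"
    and subgroup_H: "subgroup H G"
    and other_double_coset:
      "\<lbrakk>x \<in> carrier G; y \<in> carrier G; x \<notin> H <#> generate G {g}; y \<notin> H <#> generate G {g}\<rbrakk>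
        \<Longrightarrow> y \<in> (H #> x) <#> generate G {g}"
begin

abbreviation C where "C \<equiv> generate G {g}"

sublocale H: subgroup H G by (rule subgroup_H)

lemma subgroup_C: "subgroup C G"
  using g_closed by (simp add: generate_is_subgroup)

sublocale C: subgroup C G by (rule subgroup_C)

lemma over_subgroup:
  assumes "subgroup K G" "H \<subseteq> K"
  shows "two_double_cosets G g K"
proof unfold_locales
  fix x y assume xy: "x \<in> carrier G" "y \<in> carrier G" "x \<notin> K <#> C" "y \<notin> K <#> C"
  have "H <#> C \<subseteq> K <#> C" using assms(2) by (rule mono_set_mult) simp
  then have "y \<in> (H #> x) <#> C" using other_double_coset xy by blast
  then show "y \<in> (K #> x) <#> C" using assms(2) unfolding mem_double_coset by blast
qed (use finite_carrier g_closed assms in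
      \<open>auto intro: subgroup.mem_carrier subgroup.m_closed subgroup.m_inv_closed subgroup.one_closed\<close>)

lemma transitive_mono:
  assumes "subgroup K G" "subgroup L G" "K \<subseteq> L" "K <#> C = carrier G"
  shows "L <#> C = carrier G"
proof -
  have "K <#> C \<subseteq> L <#> C" using assms(3) by (rule mono_set_mult) simp
  moreover have "L <#> C \<subseteq> carrier G"
    by (rule set_mult_closed[OF subgroup.subset[OF assms(2)] C.subset])
  ultimately show ?thesis using assms(4) by blast
qed

text \<open>The double cosets of \<open>K\<close> are unions of those of \<open>H\<close>, and there are two of each, so \<open>K\<close> merges nothing.\<close>

lemma intransitive_double_cosets:
  assumes "subgroup K G" "H \<subseteq> K" "K <#> C \<noteq> carrier G"
  shows "K <#> C = H <#> C"
    and "\<lbrakk>y \<in> carrier G; y \<notin> H <#> C\<rbrakk> \<Longrightarrow> (K #> y) <#> C \<subseteq> (H #> y) <#> C"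
proof -
  interpret K: subgroup K G by fact
  have KC: "K <#> C \<subseteq> carrier G" by (rule set_mult_closed[OF K.subset C.subset])
  have HK: "H <#> C \<subseteq> K <#> C" using assms(2) by (rule mono_set_mult) simp
  obtain z where z: "z \<in> carrier G" "z \<notin> K <#> C" using assms(3) KC by blast
  \<comment> \<open>Membership in a union of double cosets is not affected by moving within a double coset.\<close>
  have stable: "k \<otimes> x \<otimes> c \<in> K <#> C \<longleftrightarrow> x \<in> K <#> C"
    if "k \<in> K" "x \<in> carrier G" "c \<in> C" for k x c
  proof
    assume "x \<in> K <#> C"
    then obtain k' c' where "k' \<in> K" "c' \<in> C" "x = k' \<otimes> c'" by (auto simp: mem_set_mult)
    then have "k \<otimes> x \<otimes> c = (k \<otimes> k') \<otimes> (c' \<otimes> c)" "k \<otimes> k' \<in> K" "c' \<otimes> c \<in> C"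
      using that by (simp_all add: m_assoc)
    then show "k \<otimes> x \<otimes> c \<in> K <#> C" unfolding mem_set_mult by blast
  next
    assume "k \<otimes> x \<otimes> c \<in> K <#> C"
    then obtain k' c' where kc: "k' \<in> K" "c' \<in> C" "k \<otimes> x \<otimes> c = k' \<otimes> c'"
      by (auto simp: mem_set_mult)
    have "x = inv k \<otimes> (k \<otimes> x \<otimes> c) \<otimes> inv c" using that by (simp add: m_assoc)
    also have "\<dots> = (inv k \<otimes> k') \<otimes> (c' \<otimes> inv c)"
      unfolding kc(3) using kc that by (simp add: m_assoc)
    finally show "x \<in> K <#> C" using kc that unfolding mem_set_mult by blast
  qed
  show eq: "K <#> C = H <#> C"
  proof (rule ccontr)
    assume "K <#> C \<noteq> H <#> C"
    then obtain x where x: "x \<in> K <#> C" "x \<notin> H <#> C" using HK by blast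
    have "z \<in> (H #> x) <#> C" using other_double_coset[of x z] x z KC HK by blast
    then obtain h c where "h \<in> H" "c \<in> C" "z = h \<otimes> x \<otimes> c"
      by (auto simp: mem_double_coset)
    then show False using stable[of h x c] x z assms(2) KC by auto
  qed
  assume y: "y \<in> carrier G" "y \<notin> H <#> C"
  show "(K #> y) <#> C \<subseteq> (H #> y) <#> C"
  proof
    fix x assume "x \<in> (K #> y) <#> C"
    then obtain k c where kc: "k \<in> K" "c \<in> C" "x = k \<otimes> y \<otimes> c"
      by (auto simp: mem_double_coset)
    then have "x \<in> carrier G" "x \<notin> H <#> C" using stable[of k y c] y eq by auto
    then show "x \<in> (H #> y) <#> C" using other_double_coset y by blast
  qed
qed

text \<open>Both groups have the double coset \<open>H <#> C\<close>, so this set is closed under left multiplication by whatever they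
  generate.\<close>

lemma not_both_intransitive:
  assumes K: "subgroup K G" "H \<subseteq> K" "K <#> C \<noteq> carrier G"
    and L: "subgroup L G" "H \<subseteq> L" "L <#> C \<noteq> carrier G"
  shows "generate G (K \<union> L) \<noteq> carrier G"
proof
  interpret K: subgroup K G by fact
  interpret L: subgroup L G by fact
  assume eq: "generate G (K \<union> L) = carrier G"
  have KL: "K <#> C = H <#> C" "L <#> C = H <#> C"
    using intransitive_double_cosets(1)[OF K] intransitive_double_cosets(1)[OF L] by simp_all
  have HC: "H <#> C \<subseteq> carrier G" by (rule set_mult_closed[OF H.subset C.subset])
  have step: "x \<otimes> s \<in> H <#> C" if "x \<in> K \<or> x \<in> L" "s \<in> H <#> C" for x s
  proof -
    have *: "x \<otimes> s \<in> P <#> C" if P: "subgroup P G" "x \<in> P" "s \<in> P <#> C" for P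
    proof -
      interpret P: subgroup P G by fact
      obtain k c where "k \<in> P" "c \<in> C" "s = k \<otimes> c" using P(3) by (auto simp: mem_set_mult)
      then have "x \<otimes> s = (x \<otimes> k) \<otimes> c" "x \<otimes> k \<in> P" using P(2) by (simp_all add: m_assoc)
      then show ?thesis using \<open>c \<in> C\<close> unfolding mem_set_mult by blast
    qed
    show ?thesis using that *[OF K(1)] *[OF L(1)] KL by auto
  qed
  have "\<forall>s \<in> H <#> C. x \<otimes> s \<in> H <#> C" if "x \<in> generate G (K \<union> L)" for x
    using that
  proof (induction rule: generate.induct)
    case one then show ?case using HC by auto
  next
    case (incl h) then show ?case using step by auto
  next
    case (inv h) then show ?case using step by auto
  next
    case (eng h1 h2)
    have "h1 \<in> carrier G" "h2 \<in> carrier G" using eng(1,2) unfolding eq by auto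
    show ?case
    proof
      fix s assume s: "s \<in> H <#> C"
      have "h1 \<otimes> h2 \<otimes> s = h1 \<otimes> (h2 \<otimes> s)"
        using s HC \<open>h1 \<in> carrier G\<close> \<open>h2 \<in> carrier G\<close> by (intro m_assoc) auto
      then show "h1 \<otimes> h2 \<otimes> s \<in> H <#> C" using eng s by simp
    qed
  qed
  then have "x \<in> H <#> C" if "x \<in> carrier G" for x
  proof -
    have "\<one> \<in> H <#> C" using subset_set_mult(1)[OF subgroup_H subgroup_C] by auto
    then have "x \<otimes> \<one> \<in> H <#> C" using \<open>\<And>x. x \<in> generate G (K \<union> L) \<Longrightarrow> _\<close> eq that by blast
    then show ?thesis using that by simp
  qed
  then show False using HC K(3) KL(1) by blast
qed

text \<open>The counterpart of Ritt's argument for two cycles.  It suffices that right multiplication by \<open>L\<close> maps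
  \<open>L <#> K\<close> to itself, for then \<open>K <#> L\<close> is contained in \<open>L <#> K\<close>.\<close>

lemma set_mult_subgroup_of_intransitive:
  assumes K: "subgroup K G" "H \<subseteq> K" "K <#> C \<noteq> carrier G"
    and L: "subgroup L G" "H \<subseteq> L" "L <#> C = carrier G"
  shows "subgroup (L <#> K) G"
proof -
  interpret K: subgroup K G by fact
  interpret L: subgroup L G by fact
  have LK_sub: "L <#> K \<subseteq> carrier G" by (rule set_mult_closed[OF L.subset K.subset])
  have HC: "H <#> C \<subseteq> carrier G" by (rule set_mult_closed[OF H.subset C.subset])
  have KC: "K <#> C = H <#> C" using intransitive_double_cosets(1)[OF K] .
  have "K \<subseteq> H <#> C" using subset_set_mult(1)[OF K(1) subgroup_C] KC by simp
  then have K_split: "K = H <#> (K \<inter> C)"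
    using set_mult_inter_of_subset[OF subgroup_H K(1) subgroup_C K(2)] by simp
  have "subgroup (L \<inter> C) G" using subgroups_Inter_pair L(1) subgroup_C by blast
  then interpret LC: subgroup "L \<inter> C" G .
  \<comment> \<open>For \<open>F \<le> C\<close> the product \<open>L <#> F\<close> only depends on the subgroup \<open>(L \<inter> C) <#> F\<close> of \<open>C\<close>, whose
    order can be read off from the size of \<open>L <#> F\<close>.\<close>
  have join: "subgroup ((L \<inter> C) <#> F) G \<and> (L \<inter> C) <#> F \<subseteq> C \<and>
      card (L <#> F) * card (L \<inter> C) = card L * card ((L \<inter> C) <#> F)
      \<and> L <#> F = L <#> ((L \<inter> C) <#> F)"
    if F: "subgroup F G" "F \<subseteq> C" for F
  proof -
    interpret F: subgroup F G by fact
    let ?D = "(L \<inter> C) <#> F"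
    have "(L \<inter> C) <#> F = F <#> (L \<inter> C)"
    proof -
      have "x \<otimes> f = f \<otimes> x" if "x \<in> L \<inter> C" "f \<in> F" for x f
        using generate_singleton_comm[OF g_closed] that F(2) by blast
      then show ?thesis unfolding set_eq_iff mem_set_mult by metis
    qed
    then have D: "subgroup ?D G"
      using set_mult_commute_subgroup[OF LC.subgroup_axioms F(1)] by simp
    have DC: "?D \<subseteq> C" using F(2) C.m_closed unfolding subset_iff mem_set_mult by blast
    have "L <#> ?D = (L <#> (L \<inter> C)) <#> F"
      using set_mult_assoc[OF L.subset LC.subset F.subset] by simp
    also have "L <#> (L \<inter> C) = L"
    proof
      show "L <#> (L \<inter> C) \<subseteq> L" by (auto simp: mem_set_mult)
      show "L \<subseteq> L <#> (L \<inter> C)" by (rule subset_set_mult(1)[OF L(1) LC.subgroup_axioms])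
    qed
    finally have LD: "L <#> ?D = L <#> F" .
    have "L \<inter> ?D = L \<inter> C"
      using DC subset_set_mult(1)[OF LC.subgroup_axioms F(1)] by blast
    then have "card (L <#> ?D) * card (L \<inter> C) = card L * card ?D"
      using card_set_mult[OF finite_carrier L(1) D] by simp
    with D DC LD show ?thesis by simp
  qed
  have LH: "L <#> H = L"
  proof
    show "L <#> H \<subseteq> L" by (auto simp: mem_set_mult subsetD[OF L(2)])
    show "L \<subseteq> L <#> H" by (rule subset_set_mult(1)[OF L(1) subgroup_H])
  qed
  have KiC: "subgroup (K \<inter> C) G" using subgroups_Inter_pair K(1) subgroup_C by blast
  then interpret KiC: subgroup "K \<inter> C" G .
  have LK: "L <#> K = L <#> (K \<inter> C)"
  proof -
    have "L <#> K = (L <#> H) <#> (K \<inter> C)"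
      using set_mult_assoc[OF L.subset H.subset KiC.subset] K_split[symmetric] by simp
    then show ?thesis using LH by simp
  qed
  \<comment> \<open>\<open>L <#> K\<close> is \<open>L <#> (K \<inter> C)\<close>.  As \<open>y \<in> L\<close> lies in the other double coset, it is also
    \<open>L <#> F\<close> shifted by \<open>inv y\<close>, for the analogous subgroup \<open>F\<close> of \<open>C\<close>.  Counting gives the two
    subgroups \<open>(L \<inter> C) <#> (K \<inter> C)\<close> and \<open>(L \<inter> C) <#> F\<close> of the cyclic group \<open>C\<close> the same order, so
    they coincide, and \<open>L <#> K\<close> is its own shift by \<open>inv y\<close>.\<close>
  have stab: "x \<otimes> y \<in> L <#> K" if x: "x \<in> L <#> K" and y: "y \<in> L" "y \<notin> H <#> C" for x y
  proof -
    let ?F = "{c \<in> C. y \<otimes> c \<otimes> inv y \<in> K}"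
    have yc: "y \<in> carrier G" using y by simp
    have F: "subgroup ?F G"
    proof (rule subgroupI)
      show "?F \<subseteq> carrier G" by auto
      have "\<one> \<in> ?F" using yc by simp
      then show "?F \<noteq> {}" by blast
      fix a assume a: "a \<in> ?F"
      have "y \<otimes> inv a \<otimes> inv y = inv (y \<otimes> a \<otimes> inv y)"
        using a yc by (simp add: inv_mult_group m_assoc)
      then show "inv a \<in> ?F" using a by simp
      fix b assume b: "b \<in> ?F"
      have "y \<otimes> (a \<otimes> b) \<otimes> inv y = (y \<otimes> a \<otimes> inv y) \<otimes> (y \<otimes> b \<otimes> inv y)"
        using a b yc by (simp add: m_assoc)
      then show "a \<otimes> b \<in> ?F" using a b by simp
    qed
    \<comment> \<open>\<open>K\<close> has the same double coset of \<open>y\<close> as \<open>H\<close>, so each \<open>k \<in> K\<close> can be written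
      \<open>h \<otimes> (y \<otimes> c \<otimes> inv y)\<close> with \<open>h \<in> H\<close> and \<open>c \<in> F\<close>.\<close>
    have LKF: "(\<lambda>u. u \<otimes> inv y) ` (L <#> ?F) = L <#> K"
    proof
      show "(\<lambda>u. u \<otimes> inv y) ` (L <#> ?F) \<subseteq> L <#> K"
      proof
        fix z assume "z \<in> (\<lambda>u. u \<otimes> inv y) ` (L <#> ?F)"
        then obtain l c where lc: "l \<in> L" "c \<in> ?F" "z = l \<otimes> c \<otimes> inv y"
          by (auto simp: mem_set_mult)
        have "z = (l \<otimes> inv y) \<otimes> (y \<otimes> c \<otimes> inv y)" using lc yc by (simp add: m_assoc)
        then show "z \<in> L <#> K" using lc y unfolding mem_set_mult by blast
      qed
      show "L <#> K \<subseteq> (\<lambda>u. u \<otimes> inv y) ` (L <#> ?F)"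
      proof
        fix z assume "z \<in> L <#> K"
        then obtain l k where lk: "l \<in> L" "k \<in> K" "z = l \<otimes> k" by (auto simp: mem_set_mult)
        have "k \<otimes> y \<otimes> \<one> \<in> (K #> y) <#> C"
          using lk C.one_closed unfolding mem_double_coset by blast
        then have "k \<otimes> y \<in> (H #> y) <#> C"
          using intransitive_double_cosets(2)[OF K yc y(2)] lk yc by auto
        then obtain h c where hc: "h \<in> H" "c \<in> C" "k \<otimes> y = h \<otimes> y \<otimes> c"
          by (auto simp: mem_double_coset)
        have k: "k = h \<otimes> (y \<otimes> c \<otimes> inv y)"
        proof -
          have "k = (k \<otimes> y) \<otimes> inv y" using lk yc by (simp add: m_assoc)
          then show ?thesis unfolding hc(3) using hc yc by (simp add: m_assoc)
        qed
        have "y \<otimes> c \<otimes> inv y = inv h \<otimes> k" unfolding k using hc yc by (simp add: m_assoc)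
        then have "c \<in> ?F" using hc(1,2) lk(2) subsetD[OF K(2)] by simp
        moreover have "z = (l \<otimes> h \<otimes> y \<otimes> c) \<otimes> inv y"
        proof -
          have "z = l \<otimes> (h \<otimes> (y \<otimes> c \<otimes> inv y))" using lk(3) k by simp
          then show ?thesis using lk(1) hc(1,2) yc by (simp add: m_assoc)
        qed
        moreover have "l \<otimes> h \<otimes> y \<in> L" using lk(1) subsetD[OF L(2) hc(1)] y by simp
        ultimately show "z \<in> (\<lambda>u. u \<otimes> inv y) ` (L <#> ?F)"
          unfolding image_iff by (intro bexI[of _ "l \<otimes> h \<otimes> y \<otimes> c"]) (auto simp: mem_set_mult)
      qed
    qed
    have LF_sub: "L <#> ?F \<subseteq> carrier G" using set_mult_closed[OF L.subset subgroup.subset[OF F]] .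
    have "inj_on (\<lambda>u. u \<otimes> inv y) (L <#> ?F)"
      using LF_sub yc by (intro inj_onI) (auto simp: subset_iff)
    then have "card (L <#> ?F) = card (L <#> K)" using LKF card_image by fastforce
    then have "card (L <#> ?F) = card (L <#> (K \<inter> C))" using LK by simp
    then have "card L * card ((L \<inter> C) <#> ?F) = card L * card ((L \<inter> C) <#> (K \<inter> C))"
      using join[OF F] join[OF KiC] by auto
    then have "card ((L \<inter> C) <#> ?F) = card ((L \<inter> C) <#> (K \<inter> C))"
      using card_subgroup_pos[OF finite_carrier L(1)] by simp
    then have "(L \<inter> C) <#> ?F = (L \<inter> C) <#> (K \<inter> C)"
      using cyclic_subgroups_of_same_card[OF finite_carrier g_closed] join[OF F] join[OF KiC]
      by auto
    then have LF: "L <#> ?F = L <#> K" using LK join[OF F] join[OF KiC] by auto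
    obtain u where u: "u \<in> L <#> K" "x = u \<otimes> inv y" using x LKF LF by auto
    then have "x \<otimes> y = u" using yc LK_sub by (auto simp: m_assoc)
    then show ?thesis using u by simp
  qed
  obtain y0 where y0: "y0 \<in> L" "y0 \<notin> H <#> C"
  proof -
    have "\<not> L \<subseteq> H <#> C"
    proof
      assume "L \<subseteq> H <#> C"
      then have "L <#> C \<subseteq> (H <#> C) <#> C" by (rule mono_set_mult) simp
      also have "\<dots> = H <#> (C <#> C)" using set_mult_assoc[OF H.subset C.subset C.subset] .
      also have "\<dots> \<subseteq> H <#> C" by (rule mono_set_mult) (auto simp: mem_set_mult)
      finally show False using L(3) K(3) KC HC by auto
    qed
    then show ?thesis using that by blast
  qed
  \<comment> \<open>Multiplying \<open>c \<in> L \<inter> C\<close> by \<open>y0\<close> moves it to the other double coset, so the elements of \<open>L\<close> outside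
    \<open>H <#> C\<close> generate \<open>L\<close> together with \<open>H\<close>.\<close>
  have stabL: "x \<otimes> l \<in> L <#> K" if x: "x \<in> L <#> K" and l: "l \<in> L" for x l
  proof (cases "l \<in> H <#> C")
    case False then show ?thesis using stab x l by blast
  next
    case True
    have xc: "x \<in> carrier G" using x LK_sub by blast
    obtain h c where hc: "h \<in> H" "c \<in> C" "l = h \<otimes> c" using True by (auto simp: mem_set_mult)
    have "c = inv h \<otimes> l" using hc by simp
    then have cL: "c \<in> L" using l subsetD[OF L(2) hc(1)] by simp
    have *: "y0 \<otimes> c \<notin> H <#> C"
    proof
      assume "y0 \<otimes> c \<in> H <#> C"
      then obtain h' c' where h': "h' \<in> H" "c' \<in> C" "y0 \<otimes> c = h' \<otimes> c'" by (auto simp: mem_set_mult)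
      have "y0 = (y0 \<otimes> c) \<otimes> inv c" using y0 hc by (simp add: m_assoc)
      also have "\<dots> = h' \<otimes> (c' \<otimes> inv c)" unfolding h'(3) using h' hc by (simp add: m_assoc)
      finally show False using y0 h' hc unfolding mem_set_mult by blast
    qed
    have xh: "x \<otimes> h \<in> L <#> K"
    proof -
      obtain a b where ab: "a \<in> L" "b \<in> K" "x = a \<otimes> b" using x by (auto simp: mem_set_mult)
      then have "x \<otimes> h = a \<otimes> (b \<otimes> h)" "b \<otimes> h \<in> K" using hc K(2) by (auto simp: m_assoc)
      then show ?thesis using ab unfolding mem_set_mult by blast
    qed
    have inv_stab: "u \<otimes> inv y0 \<in> L <#> K" if u: "u \<in> L <#> K" for u
    proof -
      have inj: "inj_on (\<lambda>x. x \<otimes> y0) (L <#> K)"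
        using LK_sub y0 by (intro inj_onI) (auto simp: subset_iff)
      have "(\<lambda>x. x \<otimes> y0) ` (L <#> K) \<subseteq> L <#> K" using stab y0 by blast
      then have "(\<lambda>x. x \<otimes> y0) ` (L <#> K) = L <#> K"
        using inj endo_inj_surj finite_subset[OF LK_sub finite_carrier] by blast
      then obtain v where v: "v \<in> L <#> K" "u = v \<otimes> y0" using u by blast
      then have "u \<otimes> inv y0 = v" using y0 LK_sub by (auto simp: m_assoc)
      then show ?thesis using v by simp
    qed
    have "x \<otimes> l = ((x \<otimes> h) \<otimes> inv y0) \<otimes> (y0 \<otimes> c)"
      using hc y0 xc by (simp add: m_assoc)
    then show ?thesis using stab[OF inv_stab[OF xh] _ *] y0 cL by simp
  qed
  have "K <#> L \<subseteq> L <#> K"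
  proof
    fix z assume "z \<in> K <#> L"
    then obtain k l where kl: "k \<in> K" "l \<in> L" "z = k \<otimes> l" by (auto simp: mem_set_mult)
    then show "z \<in> L <#> K" using stabL subset_set_mult(2)[OF L(1) K(1)] by blast
  qed
  moreover have "card (K <#> L) = card (L <#> K)"
    by (rule card_set_mult_commute[OF finite_carrier K(1) L(1)])
  ultimately have "K <#> L = L <#> K"
    using card_subset_eq[OF finite_subset[OF LK_sub finite_carrier]] by blast
  then show ?thesis using set_mult_commute_subgroup[OF L(1) K(1)] by simp
qed

section \<open>Two transitive overgroups\<close>

lemma card_transitive:
  assumes "subgroup K G" "K <#> C = carrier G"
  shows "card (carrier G) * card (K \<inter> C) = card K * card C"
  using card_set_mult[OF finite_carrier assms(1) subgroup_C] assms(2) by simp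

text \<open>Both double cosets of \<open>H\<close> have the same size: the stabilizer in \<open>C\<close> of a point is in each case determined
  by the kernels of the actions of \<open>C\<close> on the cosets of \<open>K\<close> and of \<open>L\<close>, and these kernels do not depend on
  the point.  So \<open>G\<close> is twice as large as \<open>H <#> C\<close>.\<close>

lemma card_inter_of_transitive:
  assumes K: "subgroup K G" "K <#> C = carrier G" and L: "subgroup L G" "L <#> C = carrier G"
    and H: "H = K \<inter> L" "H <#> C \<noteq> carrier G"
  shows "card (carrier G) * card (H \<inter> C) = 2 * (card H * card C)"
proof -
  have HC: "H <#> C \<subseteq> carrier G" by (rule set_mult_closed[OF H.subset C.subset])
  obtain y where y: "y \<in> carrier G" "y \<notin> H <#> C" using H(2) HC by blast
  let ?D = "(H #> y) <#> C"
  have D: "?D \<subseteq> carrier G" using y by (auto simp: mem_double_coset)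
  have disj: "(H <#> C) \<inter> ?D = {}"
  proof (rule ccontr)
    assume "(H <#> C) \<inter> ?D \<noteq> {}"
    then obtain z where z: "z \<in> H <#> C" "z \<in> ?D" by blast
    obtain h c where hc: "h \<in> H" "c \<in> C" "z = h \<otimes> y \<otimes> c" using z(2) by (auto simp: mem_double_coset)
    obtain h' c' where "h' \<in> H" "c' \<in> C" "z = h' \<otimes> c'" using z(1) by (auto simp: mem_set_mult)
    with hc have *: "h \<in> H" "c \<in> C" "h' \<in> H" "c' \<in> C" "h' \<otimes> c' = h \<otimes> y \<otimes> c" by simp_all
    have "y = inv h \<otimes> (h \<otimes> y \<otimes> c) \<otimes> inv c" using * y by (simp add: m_assoc)
    also have "\<dots> = (inv h \<otimes> h') \<otimes> (c' \<otimes> inv c)" unfolding *(5)[symmetric] using *(1-4) by (simp add: m_assoc)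
    finally show False using y(2) * unfolding mem_set_mult by blast
  qed
  have "carrier G = (H <#> C) \<union> ?D" using other_double_coset y HC D by blast
  then have "card (carrier G) = card (H <#> C) + card ?D"
    using card_Un_disjoint[OF _ _ disj] finite_subset[OF HC finite_carrier]
      finite_subset[OF D finite_carrier] by simp
  moreover have "card (H <#> C) * card (H \<inter> C) = card H * card C"
    by (rule card_set_mult[OF finite_carrier subgroup_H subgroup_C])
  moreover have "card ?D * card (H \<inter> C) = card H * card C"
  proof -
    have "{c \<in> C. y \<otimes> c \<otimes> inv y \<in> H} = H \<inter> C"
      using conj_mem_iff_of_transitive[OF g_closed K _ y(1)]
        conj_mem_iff_of_transitive[OF g_closed L _ y(1)] H(1) by auto
    then show ?thesis
      using card_double_coset[OF finite_carrier subgroup_H subgroup_C y(1)] by simp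
  qed
  ultimately show ?thesis by (simp add: algebra_simps)
qed

text \<open>Otherwise \<open>K\<close> and \<open>B\<close> would permute, and a product that is a subgroup containing \<open>B\<close> properly is
  everything, or both would be intransitive, and then they could not generate \<open>G\<close>.\<close>

lemma set_mult_eq_carrier_or_transitive:
  assumes B: "maximal_subgroup B G" and K: "subgroup K G" "\<not> K \<subseteq> B"
    and H: "H = K \<inter> B" and ne: "K <#> B \<noteq> carrier G"
  shows "H <#> C \<noteq> carrier G" "K <#> C = carrier G" "B <#> C = carrier G"
proof -
  have Bs: "subgroup B G" using B by (simp add: maximal_subgroup_def)
  have sub: "H \<subseteq> K" "H \<subseteq> B" using H by auto
  have 1: "\<not> subgroup (K <#> B) G" using set_mult_eq_carrier_of_maximal[OF B K] ne by blast
  then have 2: "\<not> subgroup (B <#> K) G" using set_mult_commute_of_subgroup[OF Bs K(1)] by auto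
  show "H <#> C \<noteq> carrier G"
    using set_mult_subgroup_of_transitive[OF g_closed subgroup_H _ K(1) sub(1) Bs sub(2)] 1 by blast
  have gen: "generate G (K \<union> B) = carrier G" by (rule maximal_subgroup_generate[OF B K])
  have "K <#> C = carrier G \<or> B <#> C = carrier G"
    using not_both_intransitive[OF K(1) sub(1) _ Bs sub(2)] gen by blast
  then show "K <#> C = carrier G" "B <#> C = carrier G"
    using set_mult_subgroup_of_intransitive[OF K(1) sub(1) _ Bs sub(2)]
      set_mult_subgroup_of_intransitive[OF Bs sub(2) _ K(1) sub(1)] 1 2 by blast+
qed

text \<open>The configuration behind the dihedral alternative.  Transitivity of \<open>K\<close> and \<open>B\<close> turns orders of
  intersections with \<open>C\<close> into indices, and these intersections lie in cores.  This yields that \<open>H <#> N\<close> has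
  index two both in \<open>K <#> N\<close> and in \<open>B\<close>; it is therefore normal in the group they generate, which is \<open>G\<close>, and so
  equals the core \<open>N\<close> of \<open>B\<close>.\<close>

lemma index_two_of_nonpermuting:
  assumes B: "maximal_subgroup B G" and K: "subgroup K G" "\<not> K \<subseteq> B"
    and H: "H = K \<inter> B" and ne: "K <#> B \<noteq> carrier G"
  defines "N \<equiv> normal_core G B"
  shows "H \<subseteq> N" "card B = 2 * card N" "card K = 2 * card H"
    "subgroup (K <#> N) G" "K <#> N \<noteq> carrier G" "card (K <#> N) = 2 * card N"
proof -
  have Bs: "subgroup B G" using B by (simp add: maximal_subgroup_def)
  interpret B: subgroup B G by fact
  interpret K: subgroup K G by fact
  have sub: "H \<subseteq> K" "H \<subseteq> B" using H by auto
  note tr = set_mult_eq_carrier_or_transitive[OF assms(1-5)]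
  have Cpos: "card C > 0" using card_subgroup_pos[OF finite_carrier subgroup_C] .
  have half: "card (carrier G) * card (H \<inter> C) = 2 * (card H * card C)"
    by (rule card_inter_of_transitive[OF K(1) tr(2) Bs tr(3) H tr(1)])
  \<comment> \<open>\<open>K \<inter> C\<close> lies in the core of \<open>K\<close>; by maximality of \<open>B\<close> that core lies in \<open>B\<close>, since otherwise its
    product with \<open>B\<close> would already be \<open>G\<close>.\<close>
  have KCB: "K \<inter> C \<subseteq> B"
  proof -
    let ?M = "normal_core G K"
    note core = normal_core_greatest[OF K(1)]
    have M: "subgroup ?M G" using core(1) normal_imp_subgroup by blast
    have "?M \<subseteq> B"
    proof (rule ccontr)
      assume nM: "\<not> ?M \<subseteq> B"
      have "subgroup (?M <#> B) G"
        using set_mult_commute_subgroup[OF M Bs] commut_normal[OF Bs core(1)] by simp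
      then have "?M <#> B = carrier G" by (rule set_mult_eq_carrier_of_maximal[OF B M nM])
      moreover have "?M <#> B \<subseteq> K <#> B" using core(2) by (rule mono_set_mult) simp
      moreover have "K <#> B \<subseteq> carrier G" by (rule set_mult_closed[OF K.subset B.subset])
      ultimately show False using ne by blast
    qed
    then show ?thesis using inter_cyclic_subset_normal_core[OF g_closed K(1) tr(2)] by blast
  qed
  then have "K \<inter> C = H \<inter> C" using H by blast
  then show cK: "card K = 2 * card H"
    using card_transitive[OF K(1) tr(2)] half Cpos by simp
  note core = normal_core_greatest[OF Bs, folded N_def]
  have N: "subgroup N G" using core(1) normal_imp_subgroup by blast
  interpret N: subgroup N G by fact
  have BCN: "B \<inter> C \<subseteq> N"
    using inter_cyclic_subset_normal_core[OF g_closed Bs tr(3)] by (simp add: N_def)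
  let ?P = "K <#> N" and ?H = "H <#> N"
  show P: "subgroup ?P G"
    using set_mult_commute_subgroup[OF K(1) N commut_normal[OF K(1) core(1)]] .
  have H': "subgroup ?H G"
    using set_mult_commute_subgroup[OF subgroup_H N commut_normal[OF subgroup_H core(1)]] .
  have KP: "K \<subseteq> ?P" "N \<subseteq> ?P" using subset_set_mult[OF K(1) N] by auto
  have HH': "H \<subseteq> ?H" "N \<subseteq> ?H" using subset_set_mult[OF subgroup_H N] by auto
  \<comment> \<open>Enlarging \<open>K\<close> by \<open>N\<close> does not change the product with \<open>B\<close>, so the pair \<open>K <#> N\<close>, \<open>B\<close> with
    intersection \<open>H <#> N\<close> is again non-permuting.  Now \<open>H <#> N\<close> contains \<open>B \<inter> C\<close>, which makes the
    index on the side of \<open>B\<close> computable as well.\<close>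
  have PB: "?P <#> B = K <#> B"
  proof -
    have "N <#> B = B"
    proof
      show "N <#> B \<subseteq> B" by (auto simp: mem_set_mult subsetD[OF core(2)])
      show "B \<subseteq> N <#> B" by (rule subset_set_mult(2)[OF N Bs])
    qed
    then show ?thesis using set_mult_assoc[OF K.subset N.subset B.subset] by simp
  qed
  then show Pne: "?P \<noteq> carrier G"
    using ne subset_set_mult(1)[OF P Bs] set_mult_closed[OF K.subset B.subset] by auto
  have inter: "?P \<inter> B = ?H"
  proof
    have "?H \<subseteq> ?P" using sub(1) by (rule mono_set_mult) simp
    moreover have "?H \<subseteq> B" by (auto simp: mem_set_mult subsetD[OF sub(2)] subsetD[OF core(2)])
    ultimately show "?H \<subseteq> ?P \<inter> B" by blast
    show "?P \<inter> B \<subseteq> ?H"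
    proof
      fix x assume x: "x \<in> ?P \<inter> B"
      then obtain k n where kn: "k \<in> K" "n \<in> N" "x = k \<otimes> n" by (auto simp: mem_set_mult)
      have "k = x \<otimes> inv n" using kn by (simp add: m_assoc)
      also have "\<dots> \<in> B" using x kn(2) core(2) by auto
      finally show "x \<in> ?H" using kn H by (auto simp: mem_set_mult)
    qed
  qed
  have Hpos: "card H > 0" "card ?H > 0"
    using card_subgroup_pos[OF finite_carrier] subgroup_H H' by auto
  have Bpos: "card B > 0" using card_subgroup_pos[OF finite_carrier Bs] .
  have "card (K <#> B) * card H = 2 * card H * card B"
    using card_set_mult[OF finite_carrier K(1) Bs] H cK by simp
  then have KB: "card (K <#> B) = 2 * card B" using Hpos by simp
  have "card (K <#> B) * card ?H = card ?P * card B"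
    using card_set_mult[OF finite_carrier P Bs] PB inter by simp
  then have cP: "card ?P = 2 * card ?H" using KB Bpos by simp
  have gen: "generate G (?P \<union> B) = carrier G"
    using maximal_subgroup_generate[OF B P] KP K(2) by blast
  have H'B: "?H \<subseteq> B" using inter by blast
  interpret H': two_double_cosets G g ?H by (rule over_subgroup[OF H' HH'(1)])
  have "?H <#> C \<noteq> carrier G"
  proof
    assume "?H <#> C = carrier G"
    then have "B = ?H <#> (B \<inter> C)"
      using set_mult_inter_of_subset[OF H' Bs subgroup_C H'B] B.subset by simp
    moreover have "?H <#> (B \<inter> C) \<subseteq> ?H"
    proof
      fix x assume "x \<in> ?H <#> (B \<inter> C)"
      then obtain h c where "h \<in> ?H" "c \<in> B \<inter> C" "x = h \<otimes> c"
        unfolding mem_set_mult[of x G ?H] by blast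
      moreover then have "c \<in> ?H" using BCN HH'(2) by blast
      ultimately show "x \<in> ?H" using H'.H.m_closed by simp
    qed
    ultimately have "B \<subseteq> ?H" by (rule ord_eq_le_trans)
    then have "B \<subseteq> ?P" using inter by blast
    then have "generate G (?P \<union> B) = ?P"
      using generate_subgroup_incl[OF _ P, of "?P \<union> B"] by (auto intro: generate.incl)
    then show False using gen Pne by simp
  qed
  then have "card (carrier G) * card (?H \<inter> C) = 2 * (card ?H * card C)"
    using H'.card_inter_of_transitive[OF P _ Bs tr(3)] inter transitive_mono[OF K(1) P KP(1) tr(2)]
    by simp
  moreover have "?H \<inter> C = B \<inter> C" using H'B BCN HH'(2) by blast
  ultimately have cB: "card B = 2 * card ?H"
    using card_transitive[OF Bs tr(3)] Cpos by simp
  have "?H \<lhd> G"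
    using index_two_both_normal[OF finite_carrier H' P _ cP Bs H'B cB gen] inter by blast
  then have "?H \<subseteq> N" using core(3) H'B by blast
  then have "?H = N" using HH' by blast
  then show "H \<subseteq> N" "card B = 2 * card N" "card ?P = 2 * card N"
    using HH' cB cP by auto
qed

section \<open>Pairs of maximal subgroups\<close>

text \<open>A group \<open>K\<close> strictly between \<open>H\<close> and \<open>A\<close> cannot satisfy \<open>K <#> B = G\<close>, for then it would have the order of
  \<open>A\<close>.  If it does not, \<open>G\<close> modulo the core of \<open>B\<close> is dihedral and the index of \<open>B\<close> is a prime \<open>r\<close>.  But
  \<open>A <#> B = G\<close> means that the indices of \<open>A\<close> and \<open>B\<close> multiply to that of \<open>H\<close>, which is twice the index of
  \<open>A \<inter> B \<inter> C\<close> in \<open>C\<close>; this makes \<open>r\<close> even.  So \<open>r = 2\<close>, and then \<open>K <#> B\<close> has the size of \<open>G\<close> after all.\<close>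

lemma inter_maximal_of_permuting:
  assumes A: "maximal_subgroup A G" and B: "maximal_subgroup B G" and "A \<noteq> B"
    and H: "H = A \<inter> B" and AB: "A <#> B = carrier G"
  shows "maximal_subgroup H (G\<lparr>carrier := A\<rparr>)"
proof -
  have As: "subgroup A G" and Bs: "subgroup B G" using A B by (simp_all add: maximal_subgroup_def)
  have pos: "card (carrier G) > 0" "card B > 0" "card C > 0" "card H > 0" "card A > 0"
    using card_subgroup_pos[OF finite_carrier] subgroup_self Bs subgroup_C subgroup_H As by auto
  have gh: "card (carrier G) * card H = card A * card B"
    using card_set_mult[OF finite_carrier As Bs] AB H by simp
  have "\<not> A \<subseteq> B" using A B \<open>A \<noteq> B\<close> unfolding maximal_subgroup_def by blast
  have "K = A" if K: "subgroup K G" "K \<subseteq> A" "H \<subseteq> K" "K \<noteq> H" for K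
  proof -
    have KH: "H = K \<inter> B" using K H by blast
    have nKB: "\<not> K \<subseteq> B" using K H by blast
    have KBH: "card (K <#> B) * card H = card K * card B"
      using card_set_mult[OF finite_carrier K(1) Bs] KH by simp
    have "K <#> B = carrier G"
    proof (rule ccontr)
      assume ne: "K <#> B \<noteq> carrier G"
      note tr = set_mult_eq_carrier_or_transitive[OF B K(1) nKB KH ne]
      note two = index_two_of_nonpermuting[OF B K(1) nKB KH ne]
      let ?N = "normal_core G B"
      note core = normal_core_greatest[OF Bs]
      have N: "subgroup ?N G" using core(1) normal_imp_subgroup by blast
      have "K <#> ?N \<noteq> B" using subset_set_mult(1)[OF K(1) N] nKB by blast
      then obtain r where r: "Factorial_Ring.prime r" "card (carrier G) = 2 * r * card ?N"
        using dihedral_quotient[OF finite_carrier core(1) two(4) _ two(6) B core(2) two(2)]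
          subset_set_mult(2)[OF K(1) N] by blast
      have AC: "A <#> C = carrier G" by (rule transitive_mono[OF K(1) As K(2) tr(2)])
      have AiC: "subgroup (A \<inter> C) G" and BiC: "subgroup (B \<inter> C) G"
        using subgroups_Inter_pair As Bs subgroup_C by auto
      \<comment> \<open>This is the subgroup of index two in \<open>C\<close> that makes the index of \<open>B\<close> even.\<close>
      let ?D = "(A \<inter> C) <#> (B \<inter> C)"
      have "(A \<inter> C) <#> (B \<inter> C) = (B \<inter> C) <#> (A \<inter> C)"
      proof -
        have "x \<otimes> f = f \<otimes> x" if "x \<in> A \<inter> C" "f \<in> B \<inter> C" for x f
          using generate_singleton_comm[OF g_closed] that by blast
        then show ?thesis unfolding set_eq_iff mem_set_mult by metis
      qed
      then have D: "subgroup ?D G" using set_mult_commute_subgroup[OF AiC BiC] by simp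
      have "(A \<inter> C) \<inter> (B \<inter> C) = H \<inter> C" using H by blast
      then have d: "card ?D * card (H \<inter> C) = card (A \<inter> C) * card (B \<inter> C)"
        using card_set_mult[OF finite_carrier AiC BiC] by simp
      have a: "card (carrier G) * card (A \<inter> C) = card A * card C" by (rule card_transitive[OF As AC])
      have b: "card (carrier G) * card (B \<inter> C) = card B * card C" by (rule card_transitive[OF Bs tr(3)])
      have h: "card (carrier G) * card (H \<inter> C) = 2 * (card H * card C)"
        by (rule card_inter_of_transitive[OF As AC Bs tr(3) H tr(1)])
      have "card ?D * 2 * (card (carrier G) * card H * card C)
          = card (carrier G) * card ?D * (2 * (card H * card C))" by simp
      also have "\<dots> = (card (carrier G) * card (A \<inter> C)) * (card (carrier G) * card (B \<inter> C))"
        unfolding h[symmetric] using d by (simp add: algebra_simps)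
      also have "\<dots> = card C * (card A * card B * card C)" unfolding a b by simp
      also have "\<dots> = card C * (card (carrier G) * card H * card C)" unfolding gh by simp
      finally have "card ?D * 2 = card C" using pos by simp
      moreover have "card (B \<inter> C) dvd card ?D"
        by (rule card_subgroup_dvd[OF finite_carrier BiC D subset_set_mult(2)[OF AiC BiC]])
      ultimately obtain s where s: "card C = card (B \<inter> C) * s * 2" by (metis dvdE)
      have "card (B \<inter> C) > 0" using card_subgroup_pos[OF finite_carrier BiC] .
      then have "card (carrier G) = 2 * s * card B" using b s by simp
      moreover have "card (carrier G) = r * card B" using r(2) two(2) by simp
      ultimately have "r = 2 * s" using pos by simp
      then have "r = 2" using r(1) by (metis dvd_triv_left primes_dvd_imp_eq two_is_prime_nat)
      then have "card (carrier G) = 2 * card B" using r(2) two(2) by simp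
      moreover have "card (K <#> B) = 2 * card B" using KBH two(3) pos by simp
      moreover have "K <#> B \<subseteq> carrier G"
        by (rule set_mult_closed[OF subgroup.subset[OF K(1)] subgroup.subset[OF Bs]])
      ultimately show False using card_subset_eq[OF finite_carrier] ne by metis
    qed
    then have "card K = card A" using KBH gh pos by simp
    then show ?thesis
      using card_subset_eq[OF finite_subset[OF subgroup.subset[OF As] finite_carrier] K(2)] by simp
  qed
  moreover have "H \<noteq> A" using \<open>\<not> A \<subseteq> B\<close> H by blast
  ultimately show ?thesis
    using H subgroup_H by (auto simp: maximal_subgroup_def subgroup_of_update_iff[OF As])
qed

text \<open>If \<open>A <#> B\<close> is not \<open>G\<close>, then \<open>index_two_of_nonpermuting\<close> applies with \<open>K = A\<close>, and the maximality of \<open>A\<close>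
  makes the core of \<open>B\<close> equal to \<open>H\<close>.\<close>

lemma maximal_pair_dichotomy:
  assumes A: "maximal_subgroup A G" and B: "maximal_subgroup B G" and "A \<noteq> B"
    and H: "H = A \<inter> B"
  shows "(maximal_subgroup H (G\<lparr>carrier := A\<rparr>) \<and> maximal_subgroup H (G\<lparr>carrier := B\<rparr>)
            \<and> carrier G = A <#> B)
       \<or> (\<exists>r::nat. Factorial_Ring.prime r \<and> G Mod normal_core G H \<cong> dihedral_group r
            \<and> card ((\<lambda>a. normal_core G H #> a) ` A) = 2
            \<and> card ((\<lambda>b. normal_core G H #> b) ` B) = 2)"
proof -
  have As: "subgroup A G" and Bs: "subgroup B G" using A B by (simp_all add: maximal_subgroup_def)
  have nAB: "\<not> A \<subseteq> B" using A B \<open>A \<noteq> B\<close> unfolding maximal_subgroup_def by blast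
  show ?thesis
  proof (cases "A <#> B = carrier G")
    case True
    then have BA: "B <#> A = carrier G"
      using set_mult_commute_of_subgroup[OF As Bs] subgroup_self by simp
    have H': "H = B \<inter> A" using H by blast
    show ?thesis
      using inter_maximal_of_permuting[OF A B \<open>A \<noteq> B\<close> H True]
        inter_maximal_of_permuting[OF B A \<open>A \<noteq> B\<close>[symmetric] H' BA] True by simp
  next
    case False
    note two = index_two_of_nonpermuting[OF B As nAB H False]
    let ?N = "normal_core G B"
    note core = normal_core_greatest[OF Bs]
    have N: "subgroup ?N G" using core(1) normal_imp_subgroup by blast
    \<comment> \<open>\<open>A\<close> is maximal as well and \<open>A <#> N\<close> is proper, so \<open>N\<close> lies in \<open>A \<inter> B\<close>.\<close>
    have AN: "A <#> ?N = A"
      using A two(4,5) subset_set_mult(1)[OF As N] unfolding maximal_subgroup_def by blast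
    then have NA: "?N \<subseteq> A" using subset_set_mult(2)[OF As N] by simp
    then have HN: "H = ?N" using two(1) core(2) H by blast
    then have "H \<lhd> G" using core(1) by simp
    then have coreH: "normal_core G H = H"
      using normal_core_greatest[OF subgroup_H] by blast
    have cA: "card A = 2 * card H" and cB: "card B = 2 * card H"
      using two(2,3) HN by auto
    have sub: "H \<subseteq> A" "H \<subseteq> B" using H by auto
    have img: "card ((\<lambda>x. H #> x) ` R) = 2" if R: "subgroup R G" "H \<subseteq> R" "card R = 2 * card H" for R
    proof -
      interpret R: subgroup R G by fact
      have "card H > 0" using card_subgroup_pos[OF finite_carrier subgroup_H] .
      then have "\<not> R \<subseteq> H" using R by auto
      then obtain p where p: "p \<in> R" "p \<notin> H" by blast
      have "(\<lambda>x. H #> x) ` R = {H, H #> p}"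
      proof
        show "{H, H #> p} \<subseteq> (\<lambda>x. H #> x) ` R"
          using p coset_join2[OF one_closed subgroup_H] R.one_closed by (auto simp: image_iff)
        show "(\<lambda>x. H #> x) ` R \<subseteq> {H, H #> p}"
        proof
          fix T assume "T \<in> (\<lambda>x. H #> x) ` R"
          then obtain x where x: "x \<in> R" "T = H #> x" by blast
          then have "x \<in> H \<or> x \<in> H #> p" using index_two_coset(1)[OF finite_carrier subgroup_H R p] by blast
          then show "T \<in> {H, H #> p}"
            using x coset_join2[of x H] repr_independence[of x H p] p subgroup_H by auto
        qed
      qed
      moreover have "H \<noteq> H #> p" using p rcos_self[of p H] subgroup_H by auto
      ultimately show ?thesis by simp
    qed
    obtain r where "Factorial_Ring.prime r" "G Mod H \<cong> dihedral_group r"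
      using dihedral_quotient[OF finite_carrier \<open>H \<lhd> G\<close> As sub(1) cA B sub(2) cB \<open>A \<noteq> B\<close>] by blast
    then show ?thesis
      unfolding coreH using img[OF As sub(1) cA] img[OF Bs sub(2) cB] by blast
  qed
qed

end

section \<open>From cycles to double cosets\<close>

text \<open>Sending \<open>x\<close> to the point \<open>inv x \<cdot> \<omega>\<close> maps the double coset \<open>H x \<langle>g\<rangle>\<close> onto a union of cycles of \<open>g\<close>, and
  points in the same cycle come from the same double coset.  The inverse is needed because \<open>G\<close> acts from
  the left while the double cosets have \<open>\<langle>g\<rangle>\<close> on the right.\<close>

lemma (in transitive_action) two_double_cosets_of_two_cycles:
  assumes fin: "finite (carrier G)" "finite E" and \<omega>: "\<omega> \<in> E"
    and g: "g \<in> carrier G" and orb: "card (orbits (subgroup_generated G {g}) E \<phi>) \<le> 2"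
    and H: "subgroup H G" "stabilizer G \<phi> \<omega> \<subseteq> H"
  shows "two_double_cosets G g H"
proof -
  interpret group G
    using group_hom by (simp add: group_hom_def)
  let ?C = "generate G {g}"
  have C: "subgroup ?C G" using g by (simp add: generate_is_subgroup)
  interpret C: subgroup ?C G by fact
  interpret H: subgroup H G by fact
  let ?orb = "\<lambda>x. {\<phi> c x | c. c \<in> ?C}"
  have orbits: "orbits (subgroup_generated G {g}) E \<phi> = ?orb ` E"
  proof -
    have "carrier (subgroup_generated G {g}) = ?C" using g by (simp add: carrier_subgroup_generated)
    then show ?thesis by (simp only: orbits_def orbit_def Setcompr_eq_image Collect_mem_eq)
  qed
  have one: "\<phi> \<one> x = x" if "x \<in> E" for x
    using fun_cong[OF id_eq_one, of x] that by simp
  have self: "x \<in> ?orb x" if "x \<in> E" for x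
    using one[OF that] by (intro CollectI exI[of _ \<one>]) simp
  have stab: "inv x \<otimes> z \<in> H" if "x \<in> carrier G" "z \<in> carrier G" "\<phi> x \<omega> = \<phi> z \<omega>" for x z
  proof -
    have "\<phi> (inv x \<otimes> z) \<omega> = \<phi> (inv x) (\<phi> x \<omega>)"
      using that composition_rule[OF \<omega>] by simp
    also have "\<dots> = \<phi> (inv x \<otimes> x) \<omega>" using that(1) composition_rule[OF \<omega>, of "inv x" x] by (simp del: l_inv)
    also have "\<dots> = \<omega>" using that(1) one[OF \<omega>] by simp
    finally show ?thesis using that(1,2) H(2) by (auto simp: stabilizer_def)
  qed
  have cosets: "x \<in> (H #> y) <#> ?C"
    if x: "x \<in> carrier G" and y: "y \<in> carrier G" and e: "\<phi> (inv x) \<omega> \<in> ?orb (\<phi> (inv y) \<omega>)" for x y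
  proof -
    obtain c where c: "c \<in> ?C" "\<phi> (inv x) \<omega> = \<phi> c (\<phi> (inv y) \<omega>)" using e by blast
    then have "\<phi> (inv x) \<omega> = \<phi> (c \<otimes> inv y) \<omega>"
      using composition_rule[OF \<omega>] y by simp
    then have "inv (inv x) \<otimes> (c \<otimes> inv y) \<in> H" using stab[of "inv x" "c \<otimes> inv y"] x y c by simp
    then have h: "x \<otimes> c \<otimes> inv y \<in> H" using x y c by (simp add: m_assoc)
    have "x = (x \<otimes> c \<otimes> inv y) \<otimes> y \<otimes> inv c" using x y c(1) by (simp add: m_assoc)
    then show ?thesis using h c(1) unfolding mem_double_coset by blast
  qed
  show ?thesis
  proof unfold_locales
    fix x y assume x: "x \<in> carrier G" and y: "y \<in> carrier G"
      and nx: "x \<notin> H <#> ?C" and ny: "y \<notin> H <#> ?C"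
    have pts: "\<phi> (inv z) \<omega> \<in> E" if "z \<in> carrier G" for z
      using that element_image[OF _ \<omega> refl] by simp
    have other: "?orb (\<phi> (inv z) \<omega>) \<noteq> ?orb \<omega>" if "z \<in> carrier G" "z \<notin> H <#> ?C" for z
    proof
      assume "?orb (\<phi> (inv z) \<omega>) = ?orb \<omega>"
      then have "\<phi> (inv z) \<omega> \<in> ?orb (\<phi> (inv \<one>) \<omega>)" using self[OF pts[OF that(1)]] one[OF \<omega>] by simp
      then have "z \<in> (H #> \<one>) <#> ?C" by (rule cosets[OF that(1) one_closed])
      then show False using that(2) H.subset by simp
    qed
    have "?orb (\<phi> (inv x) \<omega>) = ?orb (\<phi> (inv y) \<omega>)"
    proof (rule ccontr)
      assume "?orb (\<phi> (inv x) \<omega>) \<noteq> ?orb (\<phi> (inv y) \<omega>)"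
      then have "card {?orb \<omega>, ?orb (\<phi> (inv x) \<omega>), ?orb (\<phi> (inv y) \<omega>)} = 3"
        using other[OF x nx] other[OF y ny] by (simp add: eq_commute)
      moreover have "{?orb \<omega>, ?orb (\<phi> (inv x) \<omega>), ?orb (\<phi> (inv y) \<omega>)} \<subseteq> ?orb ` E"
        using pts[OF x] pts[OF y] \<omega> by blast
      then have "card {?orb \<omega>, ?orb (\<phi> (inv x) \<omega>), ?orb (\<phi> (inv y) \<omega>)} \<le> card (?orb ` E)"
        by (rule card_mono[OF finite_imageI[OF fin(2)]])
      ultimately show False using orb unfolding orbits by linarith
    qed
    then have "\<phi> (inv y) \<omega> \<in> ?orb (\<phi> (inv x) \<omega>)" using self[OF pts[OF y]] by simp
    then show "y \<in> (H #> x) <#> ?C" by (rule cosets[OF y x])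
  qed (use fin g in auto)
qed

theorem theorem1p4:
  fixes \<Omega> :: "'a set"
    and G :: "('a \<Rightarrow> 'a) monoid"
    and \<omega> :: 'a
    and A B H :: "('a \<Rightarrow> 'a) set"
  assumes "finite \<Omega>"
    and "permutation_group \<Omega> G"
    and "transitive_action G \<Omega> (\<lambda>g. g)"
    and "\<omega> \<in> \<Omega>"
    and "\<exists>g \<in> carrier G. card (orbits (subgroup_generated G {g}) \<Omega> (\<lambda>h. h)) \<le> 2"
    and "maximal_subgroup A G"
    and "maximal_subgroup B G"
    and "A \<noteq> B"
    and "H = A \<inter> B"
    and "stabilizer G (\<lambda>g. g) \<omega> \<subseteq> H"
  shows "(maximal_subgroup H (G\<lparr>carrier := A\<rparr>) \<and> maximal_subgroup H (G\<lparr>carrier := B\<rparr>)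
            \<and> carrier G = A <#>\<^bsub>G\<^esub> B)
       \<or> (\<exists>r::nat. Factorial_Ring.prime r \<and> G Mod normal_core G H \<cong> dihedral_group r
            \<and> card ((\<lambda>a. normal_core G H #>\<^bsub>G\<^esub> a) ` A) = 2
            \<and> card ((\<lambda>b. normal_core G H #>\<^bsub>G\<^esub> b) ` B) = 2)"
proof -
  interpret act: transitive_action G \<Omega> "\<lambda>g. g" by fact
  interpret group G
    using act.group_hom by (simp add: group_hom_def)
  have "carrier G \<subseteq> Bij \<Omega>" using act.bij_prop0 by blast
  also have "\<dots> \<subseteq> \<Omega> \<rightarrow>\<^sub>E \<Omega>"
    unfolding PiE_def by (intro Int_greatest subsetI) (fact Bij_imp_funcset, fact Bij_imp_extensional)
  finally have fin: "finite (carrier G)"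
    by (rule finite_subset) (simp add: finite_PiE assms(1))
  obtain g where g: "g \<in> carrier G" and orb: "card (orbits (subgroup_generated G {g}) \<Omega> (\<lambda>h. h)) \<le> 2"
    using assms(5) by blast
  have "subgroup H G"
    using assms(6,7,9) subgroups_Inter_pair by (simp add: maximal_subgroup_def)
  then interpret two_double_cosets G g H
    by (rule act.two_double_cosets_of_two_cycles[OF fin assms(1,4) g orb _ assms(10)])
  show ?thesis by (rule maximal_pair_dichotomy[OF assms(6-9)])
qed

end
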